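(* Let $d\ge 2$ and $n\ge 2$ be integers, and let $V_n^d=\nu_d(\mathbb{P}^n)$ be the $d$-th Veronese variety. Then $$\tilde{\mathcal{E}}_d(V_n^d)=\mathcal{E}_d(V_n^d)=\{\nu_d(A)\mid A\in\mathcal{S}_d(\mathbb{P}^n)\text{ is contained in a line}\}.$$ Moreover, the contact locus $C(\nu_d(A))$ of any $\nu_d(A)\in\mathcal{E}_d(V_n^d)$ is a degree-$d$ rational normal curve $\nu_d(L)\subset V_n^d$, where $L\subset\mathbb{P}^n$ is a line containing $A$.
   Context: The base field is $\mathbb{C}$. $\nu_d:\mathbb{P}^n\to\mathbb{P}^N$, $N=\binom{n+d}{d}-1$, is the Veronese embedding given by the complete linear system $|\mathcal{O}_{\mathbb{P}^n}(d)|$. For an integral nondegenerate variety $X\subset\mathbb{P}^N$, $X_{\mathrm{sm}}$ is its smooth locus and $\mathcal{S}_r(X)$ is the set of (unordered) sets of $r$ distinct smooth points of $X$. For a finite $A\subset X_{\mathrm{sm}}$, $2A$ is the zero-dimensional scheme with ideal sheaf $(\mathcal{I}_{A,X})^2$, and $\langle 2A\rangle\subseteq\mathbb{P}^N$ is its linear span, i.e. the span of the union of the tangent spaces $T_pX$, $p\in A$. The $r$-th strong base locus of $X$ is $$\mathcal{E}_r(X)=\{A\in\mathcal{S}_r(X)\mid \langle 2A\rangle\neq\mathbb{P}^N\text{ and }\langle 2(A\cup\{q\})\rangle=\langle 2A\rangle\text{ for some }q\in X_{\mathrm{sm}}\setminus A\}.$$ The (tangential) contact locus of $A$ is $C(A)=\mathrm{Sing}(\langle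 2A\rangle\cap X_{\mathrm{sm}})$, meaning the set of $x\in X_{\mathrm{sm}}$ with $T_xX\subseteq\langle 2A\rangle$, and $$\tilde{\mathcal{E}}_r(X)=\{A\in\mathcal{S}_r(X)\mid \langle 2A\rangle\neq\mathbb{P}^N\text{ and }\dim C(A)>0\}.$$ *)

theory Defs
  imports "HOL-Analysis.Analysis" "HOL-Library.Function_Algebras" "HOL-Library.Extended_Nat"
begin

section \<open>Coordinate vector spaces and projective spaces over the complex numbers\<close>

definition cscale :: "complex \<Rightarrow> ('i \<Rightarrow> complex) \<Rightarrow> 'i \<Rightarrow> complex" where
  "cscale c v = (\<lambda>i. c * v i)"

global_interpretation cv: vector_space "cscale :: complex \<Rightarrow> ('i \<Rightarrow> complex) \<Rightarrow> 'i \<Rightarrow> complex"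
  by unfold_locales (auto simp: cscale_def fun_eq_iff algebra_simps)

text \<open>
  Since dimensions vary, coordinates are indexed by a finite set \<open>I\<close>; vectors are functions
  vanishing off \<open>I\<close>. A point of projective space is a one-dimensional linear subspace, and
  for a linear subspace \<open>W\<close>, \<open>projectivization W\<close> is the projective linear subspace
  (of projective dimension \<open>dim W - 1\<close>) as a set of points.
\<close>

type_synonym 'i point = "('i \<Rightarrow> complex) set"

definition coord_space :: "'i set \<Rightarrow> ('i \<Rightarrow> complex) set" where
  "coord_space I = {v. \<forall>i. i \<notin> I \<longrightarrow> v i = 0}"

definition projectivization :: "('i \<Rightarrow> complex) set \<Rightarrow> 'i point set" where
  "projectivization W = {cv.span {v} | v. v \<in> W \<and> v \<noteq> 0}"

definition proj_space :: "'i set \<Rightarrow> 'i point set" where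
  "proj_space I = projectivization (coord_space I)"

definition proj_span :: "'i point set \<Rightarrow> 'i point set" where
  "proj_span S = projectivization (cv.span (\<Union>S))"

definition proj_line :: "'i set \<Rightarrow> 'i point set \<Rightarrow> bool" where
  "proj_line I L \<longleftrightarrow>
     (\<exists>W. cv.subspace W \<and> W \<subseteq> coord_space I \<and> cv.dim W = 2 \<and> L = projectivization W)"


section \<open>Forms and the Zariski topology\<close>

definition exponents :: "'i set \<Rightarrow> nat \<Rightarrow> ('i \<Rightarrow> nat) set" where
  "exponents I k = {m. (\<forall>i. i \<notin> I \<longrightarrow> m i = 0) \<and> (\<Sum>i\<in>I. m i) = k}"

definition monomial :: "'i set \<Rightarrow> ('i \<Rightarrow> nat) \<Rightarrow> ('i \<Rightarrow> complex) \<Rightarrow> complex" where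
  "monomial I m v = (\<Prod>i\<in>I. v i ^ m i)"

text \<open>
  Homogeneous polynomials of degree \<open>k\<close> in the variables \<open>I\<close>, as polynomial functions
  (harmless, as the complex field is infinite).
\<close>

definition forms :: "'i set \<Rightarrow> nat \<Rightarrow> (('i \<Rightarrow> complex) \<Rightarrow> complex) set" where
  "forms I k = {\<lambda>v. \<Sum>m\<in>exponents I k. c m * monomial I m v | c. True}"

definition vanishes_at :: "(('i \<Rightarrow> complex) \<Rightarrow> complex) \<Rightarrow> 'i point \<Rightarrow> bool" where
  "vanishes_at f p \<longleftrightarrow> (\<forall>v\<in>p. f v = 0)"

definition zariski :: "'i set \<Rightarrow> 'i point topology" where
  "zariski I = topology_generated_by
     {{p \<in> proj_space I. \<not> vanishes_at f p} | f k. f \<in> forms I k}"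

definition irreducible_in :: "'a topology \<Rightarrow> 'a set \<Rightarrow> bool" where
  "irreducible_in T Z \<longleftrightarrow> Z \<noteq> {} \<and> Z \<subseteq> topspace T \<and>
     (\<forall>F G. closedin T F \<and> closedin T G \<and> Z \<subseteq> F \<union> G \<longrightarrow> Z \<subseteq> F \<or> Z \<subseteq> G)"

text \<open>Krull dimension; with this convention the empty space has dimension 0.\<close>

definition krull_dim :: "'a topology \<Rightarrow> enat" where
  "krull_dim T = Sup {enat k | k. \<exists>Z. (\<forall>i\<le>k. closedin T (Z i) \<and> irreducible_in T (Z i)) \<and>
     (\<forall>i<k. Z i \<subset> Z (Suc i))}"

definition proj_dim :: "'i set \<Rightarrow> 'i point set \<Rightarrow> enat" where
  "proj_dim I X = krull_dim (subtopology (zariski I) X)"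


section \<open>Embedded tangent spaces, smooth points and contact loci\<close>

text \<open>
  In what follows \<open>X\<close> is a variety in \<open>proj_space I\<close>. The affine cone over the embedded
  projective tangent space at \<open>p\<close> is the common kernel of the differentials at \<open>p\<close> of all forms
  in the homogeneous ideal of \<open>X\<close>; \<open>deriv\<close> computes the partial derivatives.
\<close>

definition tangent_cone :: "'i set \<Rightarrow> 'i point set \<Rightarrow> 'i point \<Rightarrow> ('i \<Rightarrow> complex) set" where
  "tangent_cone I X p = {w \<in> coord_space I.
     \<forall>k. \<forall>f\<in>forms I k. (\<forall>q\<in>X. vanishes_at f q) \<longrightarrow>
       (\<forall>v\<in>p. (\<Sum>i\<in>I. deriv (\<lambda>t. f (v(i := t))) (v i) * w i) = 0)}"

definition tangent_space :: "'i set \<Rightarrow> 'i point set \<Rightarrow> 'i point \<Rightarrow> 'i point set" where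
  "tangent_space I X p = projectivization (tangent_cone I X p)"

text \<open>
  Jacobian criterion: \<open>p\<close> is smooth iff the projective tangent space has the dimension of \<open>X\<close>;
  the summand 1 passes from projective dimension to the dimension of the affine cone.
\<close>

definition smooth_locus :: "'i set \<Rightarrow> 'i point set \<Rightarrow> 'i point set" where
  "smooth_locus I X = {p \<in> X. enat (cv.dim (tangent_cone I X p)) = proj_dim I X + 1}"

definition smooth_sets :: "'i set \<Rightarrow> nat \<Rightarrow> 'i point set \<Rightarrow> 'i point set set" where
  "smooth_sets I r X = {A. A \<subseteq> smooth_locus I X \<and> finite A \<and> card A = r}"

text \<open>The linear span of the double-point scheme \<open>2A\<close>.\<close>

definition double_span :: "'i set \<Rightarrow> 'i point set \<Rightarrow> 'i point set \<Rightarrow> 'i point set" where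
  "double_span I X A = proj_span (\<Union>p\<in>A. tangent_space I X p)"

definition strong_base_locus :: "'i set \<Rightarrow> nat \<Rightarrow> 'i point set \<Rightarrow> 'i point set set" where
  "strong_base_locus I r X = {A \<in> smooth_sets I r X. double_span I X A \<noteq> proj_space I \<and>
     (\<exists>q \<in> smooth_locus I X - A. double_span I X (A \<union> {q}) = double_span I X A)}"

definition contact_locus :: "'i set \<Rightarrow> 'i point set \<Rightarrow> 'i point set \<Rightarrow> 'i point set" where
  "contact_locus I X A = {x \<in> smooth_locus I X. tangent_space I X x \<subseteq> double_span I X A}"

definition contact_base_locus :: "'i set \<Rightarrow> nat \<Rightarrow> 'i point set \<Rightarrow> 'i point set set" where
  "contact_base_locus I r X = {A \<in> smooth_sets I r X. double_span I X A \<noteq> proj_space I \<and>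
     proj_dim I (contact_locus I X A) > 0}"


section \<open>Veronese varieties and rational normal curves\<close>

text \<open>
  The Veronese embedding sends \<open>[v]\<close> to the point whose coordinates are all degree \<open>d\<close>
  monomials in \<open>v\<close>, so the target space has coordinates indexed by \<open>exponents I d\<close>.
  The projective \<open>n\<close>-space is \<open>proj_space {..n}\<close>, with \<open>n + 1\<close> coordinates.
\<close>

definition veronese_vec :: "'i set \<Rightarrow> nat \<Rightarrow> ('i \<Rightarrow> complex) \<Rightarrow> ('i \<Rightarrow> nat) \<Rightarrow> complex" where
  "veronese_vec I d v = (\<lambda>m. if m \<in> exponents I d then monomial I m v else 0)"

definition veronese :: "'i set \<Rightarrow> nat \<Rightarrow> 'i point \<Rightarrow> ('i \<Rightarrow> nat) point" where
  "veronese I d p = cv.span (veronese_vec I d ` p)"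

definition veronese_variety :: "nat \<Rightarrow> nat \<Rightarrow> (nat \<Rightarrow> nat) point set" where
  "veronese_variety n d = veronese {..n} d ` proj_space {..n}"

text \<open>
  A rational normal curve of degree \<open>d\<close> is the image of the \<open>d\<close>-th Veronese embedding of the
  projective line under an injective linear map of the ambient projective \<open>d\<close>-space.
\<close>

definition rational_normal_curve :: "'j set \<Rightarrow> nat \<Rightarrow> 'j point set \<Rightarrow> bool" where
  "rational_normal_curve J d R \<longleftrightarrow>
     (\<exists>\<phi> :: ((nat \<Rightarrow> nat) \<Rightarrow> complex) \<Rightarrow> 'j \<Rightarrow> complex.
        Vector_Spaces.linear cscale cscale \<phi> \<and>
        inj_on \<phi> (coord_space (exponents {..1} d)) \<and>
        \<phi> ` coord_space (exponents {..1} d) \<subseteq> coord_space J \<and>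
        R = (\<lambda>p. \<phi> ` p) ` veronese_variety 1 d)"

end

theory Submission
  imports Defs
begin

text \<open>
  By duality between tangent spaces and hyperplane sections, the tangent space at the image of \<open>q\<close>
  lies in the span of the tangent spaces at the images of \<open>A\<close> iff every degree \<open>d\<close> form singular along \<open>A\<close> is singular at \<open>q\<close>.
  If the \<open>d\<close> points of \<open>A\<close> lie on a line \<open>L\<close>, the partial derivatives of such a form have degree \<open>d - 1\<close>
  and \<open>d\<close> zeros on \<open>L\<close>, so the form is singular along \<open>L\<close>; the \<open>d\<close>-th power of a linear form
  excludes the points off \<open>L\<close>. If \<open>A\<close> is not collinear and \<open>q\<close> is not in \<open>A\<close>, a product of \<open>d\<close> linear forms,
  at least two of which vanish at each point of \<open>A\<close> and at most one at \<open>q\<close>, is singular along \<open>A\<close> but not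
  at \<open>q\<close>: join points of \<open>A\<close> on different lines through \<open>q\<close>, and if more than half of \<open>A\<close> lies on one
  line through \<open>q\<close>, use one form vanishing on that line.
\<close>

section \<open>Linear algebra in coordinates\<close>

text \<open>Both loci are tested on one object, \<open>singular_closure\<close>. Adding
  \<open>q\<close> to \<open>A\<close> keeps the double span exactly when the tangent space at the
  image of \<open>q\<close> already lies in it; so, apart from properness of the span, one locus
  asks for a point of the closure outside \<open>A\<close>, the other for positive dimension of its
  image. As the closure is either \<open>A\<close> or a whole line, \<open>krull_dim\<close> only
  has to tell zero from positive.

  The product construction obeys a count. Double zeros at all \<open>d\<close> points cost 2d
  incidences, exactly what \<open>d\<close> forms through two points each supply. Pairs on a common
  line through \<open>q\<close> must be avoided, which is impossible once such a line carries more
  than half of \<open>A\<close>. That line then gets a form of its own; it vanishes at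
  \<open>q\<close>, but a single vanishing factor leaves the product nonsingular there.

  Tangent spaces are defined by the homogeneous ideal, so they must first be identified with images
  of the differential of the Veronese map; quadrics in the ideal suffice for this.\<close>

lemma sum_fun_apply: "(\<Sum>a\<in>A. f a) x = (\<Sum>a\<in>A. f a x)"
  for f :: "'a \<Rightarrow> 'b \<Rightarrow> 'c::comm_monoid_add"
  by (induction A rule: infinite_finite_induct) auto

lemma cscale_apply [simp]: "cscale c v i = c * v i"
  by (simp add: cscale_def)

lemma subspace_coord_space: "cv.subspace (coord_space I)"
  by (auto simp: cv.subspace_def coord_space_def)

lemma coord_space_add: "u \<in> coord_space I \<Longrightarrow> v \<in> coord_space I \<Longrightarrow> u + v \<in> coord_space I"
  and coord_space_scale: "v \<in> coord_space I \<Longrightarrow> cscale c v \<in> coord_space I"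
  by (auto simp: coord_space_def)

lemma span_singleton: "cv.span {v} = range (\<lambda>c. cscale c v)"
  by (rule cv.span_singleton)

lemma span_scale_nonzero:
  assumes "c \<noteq> 0" shows "cv.span {cscale c v} = cv.span {v}"
proof -
  have "cscale a v = cscale (a / c) (cscale c v)" for a using assms by (simp add: cscale_def)
  moreover have "cscale a (cscale c v) = cscale (a * c) v" for a by (simp add: cscale_def mult.assoc)
  ultimately show ?thesis unfolding span_singleton by (fastforce simp: image_iff set_eq_iff)
qed

lemma span_eq_imp_scale:
  assumes "cv.span {v} = cv.span {w}" "v \<noteq> 0"
  obtains c where "c \<noteq> 0" "v = cscale c w"
proof -
  have "v \<in> cv.span {w}" using assms(1) cv.span_base[of v "{v}"] by auto
  then obtain c where "v = cscale c w" unfolding span_singleton by auto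
  moreover have "c \<noteq> 0" using assms(2) calculation by (auto simp: fun_eq_iff)
  ultimately show thesis using that by blast
qed

lemma point_cases:
  assumes "p \<in> projectivization W"
  obtains v where "v \<in> W" "v \<noteq> 0" "p = cv.span {v}"
  using assms unfolding projectivization_def by auto

lemma span_in_projectivization:
  assumes "cv.subspace W" "v \<noteq> 0"
  shows "cv.span {v} \<in> projectivization W \<longleftrightarrow> v \<in> W"
proof
  assume "cv.span {v} \<in> projectivization W"
  then obtain w where w: "w \<in> W" "cv.span {v} = cv.span {w}" unfolding projectivization_def by auto
  have "cv.span {w} \<subseteq> W" using w(1) assms(1) by (intro cv.span_minimal) auto
  moreover have "v \<in> cv.span {v}" by (simp add: cv.span_base)
  ultimately show "v \<in> W" using w(2) by auto
qed (use assms in \<open>auto simp: projectivization_def\<close>)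

lemma span_in_proj_space: "v \<noteq> 0 \<Longrightarrow> cv.span {v} \<in> proj_space I \<longleftrightarrow> v \<in> coord_space I"
  unfolding proj_space_def by (rule span_in_projectivization[OF subspace_coord_space])

lemma projectivization_subset_iff:
  assumes "cv.subspace W" "cv.subspace W'"
  shows "projectivization W \<subseteq> projectivization W' \<longleftrightarrow> W \<subseteq> W'"
proof
  assume L: "projectivization W \<subseteq> projectivization W'"
  show "W \<subseteq> W'"
  proof
    fix v assume "v \<in> W"
    show "v \<in> W'"
    proof (cases "v = 0")
      case True then show ?thesis using cv.subspace_0[OF assms(2)] by simp
    next
      case False
      then have "cv.span {v} \<in> projectivization W'"
        using span_in_projectivization[OF assms(1) False] \<open>v \<in> W\<close> L by auto
      then show ?thesis using span_in_projectivization[OF assms(2) False] by simp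
    qed
  qed
qed (auto simp: projectivization_def)

lemma projectivization_eq_iff:
  assumes "cv.subspace W" "cv.subspace W'"
  shows "projectivization W = projectivization W' \<longleftrightarrow> W = W'"
  using projectivization_subset_iff[OF assms] projectivization_subset_iff[OF assms(2,1)] by blast

lemma span_Union_projectivization:
  assumes "\<And>a. a \<in> A \<Longrightarrow> cv.subspace (W a)"
  shows "cv.span (\<Union>(\<Union>a\<in>A. projectivization (W a))) = cv.span (\<Union>a\<in>A. W a)"
proof (rule cv.span_eq[THEN iffD2], intro conjI subsetI)
  fix x assume "x \<in> \<Union>(\<Union>a\<in>A. projectivization (W a))"
  then obtain a v where "a \<in> A" "v \<in> W a" "x \<in> cv.span {v}"
    unfolding projectivization_def by auto
  moreover have "cv.span {v} \<subseteq> W a" using calculation assms by (intro cv.span_minimal) auto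
  ultimately show "x \<in> cv.span (\<Union>a\<in>A. W a)" by (meson UN_I cv.span_base subset_iff)
next
  fix x assume "x \<in> (\<Union>a\<in>A. W a)"
  then obtain a where a: "a \<in> A" "x \<in> W a" by auto
  show "x \<in> cv.span (\<Union>(\<Union>a\<in>A. projectivization (W a)))"
  proof (cases "x = 0")
    case True then show ?thesis by (simp add: cv.span_zero)
  next
    case False
    then have "cv.span {x} \<in> projectivization (W a)" using a unfolding projectivization_def by auto
    then show ?thesis using a cv.span_base[of x "{x}"] by (intro cv.span_base) auto
  qed
qed

lemma coord_decomp:
  assumes "finite J" "v \<in> coord_space J"
  shows "v = (\<Sum>m\<in>J. cscale (v m) (\<lambda>i. if i = m then 1 else 0))"
proof
  fix i
  have "(\<Sum>m\<in>J. v m * (if i = m then 1 else 0)) = (if i \<in> J then v i else 0)"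
    using assms(1) by (simp add: if_distrib sum.delta cong: if_cong)
  then show "v i = (\<Sum>m\<in>J. cscale (v m) (\<lambda>i. if i = m then 1 else 0)) i"
    using assms(2) by (auto simp: sum_fun_apply coord_space_def)
qed

text \<open>A basis of \<open>W\<close> together with \<open>w\<close> extends to a basis of the
  full function space, and the \<open>w\<close>-coordinate with respect to it separates. On vectors
  supported in the finite set \<open>J\<close> this functional is determined by its values on unit
  vectors, which are the coefficients \<open>c\<close>.\<close>

lemma separating_functional:
  assumes J: "finite J" and W: "cv.subspace W" "W \<subseteq> coord_space J"
    and w: "w \<in> coord_space J" "w \<notin> W"
  obtains c where "\<And>v. v \<in> W \<Longrightarrow> (\<Sum>m\<in>J. c m * v m) = 0" "(\<Sum>m\<in>J. c m * w m) \<noteq> 0"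
proof -
  obtain B where B: "B \<subseteq> W" "cv.independent B" "W \<subseteq> cv.span B"
    using cv.basis_exists by metis
  have "cv.span B \<subseteq> W" using B(1) W(1) by (rule cv.span_minimal)
  then have wB: "w \<notin> cv.span B" using w(2) by auto
  then have ind: "cv.independent (insert w B)" using B(2) by (simp add: cv.independent_insert)
  define E where "E = cv.extend_basis (insert w B)"
  have E: "cv.independent E" "insert w B \<subseteq> E" "cv.span E = UNIV"
    using ind by (auto simp: E_def cv.independent_extend_basis cv.extend_basis_superset
        cv.span_extend_basis dest: cv.extend_basis_superset[THEN subsetD])
  define \<psi> where "\<psi> v = cv.representation E v w" for v
  have add: "\<psi> (u + v) = \<psi> u + \<psi> v" for u v
    unfolding \<psi>_def using cv.representation_add[OF E(1), of v u] E(3) by simp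
  have scale: "\<psi> (cscale a v) = a * \<psi> v" for a v
    unfolding \<psi>_def using cv.representation_scale[OF E(1), of v a] E(3) by simp
  have zero: "\<psi> 0 = 0" unfolding \<psi>_def by (simp add: cv.representation_zero)
  have \<psi>_sum: "\<psi> (\<Sum>m\<in>K. f m) = (\<Sum>m\<in>K. \<psi> (f m))" for K and f :: "'a \<Rightarrow> _"
  proof (induction K rule: infinite_finite_induct)
    case (infinite K)
    then show ?case by (simp only: sum.infinite[OF infinite] zero)
  next
    case empty
    show ?case by (simp only: sum.empty zero)
  next
    case (insert x F)
    then show ?case by (simp only: sum.insert[OF insert(1,2)] add)
  qed
  have coord: "\<psi> v = (\<Sum>m\<in>J. \<psi> (\<lambda>i. if i = m then 1 else 0) * v m)" if "v \<in> coord_space J" for v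
    by (subst coord_decomp[OF J that]) (simp add: \<psi>_sum scale mult.commute)
  have "\<psi> w = 1" unfolding \<psi>_def using cv.representation_basis[OF E(1)] E(2) by auto
  moreover have "\<psi> v = 0" if "v \<in> W" for v
  proof -
    have "cv.representation E v = cv.representation B v"
      using that B E by (intro cv.representation_extend) auto
    moreover have "w \<notin> B" using wB cv.span_base by blast
    ultimately show ?thesis unfolding \<psi>_def using cv.representation_ne_zero by fastforce
  qed
  ultimately have "\<psi> w = 1" "\<And>v. v \<in> W \<Longrightarrow> \<psi> v = 0" by auto
  then show thesis
    using that[of "\<lambda>m. \<psi> (\<lambda>i. if i = m then 1 else 0)"] coord[OF subsetD[OF W(2)]] coord[OF w(1)]
    by auto
qed

text \<open>Injectivity is asked on \<open>S\<close> only, because the map of interest,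
  \<open>veronese_deriv\<close>, ignores all coordinates outside the index set.\<close>

lemma dim_image_inj:
  fixes f :: "('i \<Rightarrow> complex) \<Rightarrow> ('j \<Rightarrow> complex)"
  assumes lin: "Vector_Spaces.linear cscale cscale f" and S: "cv.subspace S" and inj: "inj_on f S"
  shows "cv.dim (f ` S) = cv.dim S"
proof -
  interpret f: Vector_Spaces.linear cscale cscale f by (rule lin)
  obtain B where B: "B \<subseteq> S" "cv.independent B" "S \<subseteq> cv.span B" "card B = cv.dim S"
    using cv.basis_exists by metis
  have sp: "cv.span B = S" using B S by (metis cv.span_minimal subset_antisym)
  have "cv.independent (f ` B)" using f.independent_injective_image[OF B(2)] inj sp by simp
  moreover have "cv.span (f ` B) = f ` S" using f.span_image[of B] sp by simp
  moreover have "card (f ` B) = card B" using inj B(1) by (meson card_image inj_on_subset)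
  ultimately show ?thesis using cv.dim_eq_card_independent B(4)
    by (metis cv.dim_span)
qed

lemma linear_cscaleI:
  fixes f :: "('i \<Rightarrow> complex) \<Rightarrow> ('j \<Rightarrow> complex)"
  assumes "\<And>u v. f (u + v) = f u + f v" "\<And>c v. f (cscale c v) = cscale c (f v)"
  shows "Vector_Spaces.linear cscale cscale f"
  by unfold_locales (use assms in auto)

text \<open>The conjunct \<open>v \<noteq> w\<close> matters: for equal vectors the set
  \<open>{v, w}\<close> collapses to a singleton, which is independent as soon as \<open>v\<close>
  is nonzero.\<close>

lemma independent_pair_iff:
  "v \<noteq> w \<and> cv.independent {v, w} \<longleftrightarrow> v \<noteq> 0 \<and> w \<notin> cv.span {v}"
proof (cases "v = w")
  case True
  have "v \<in> cv.span {v}" by (simp add: cv.span_base)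
  then show ?thesis using True by auto
next
  case False
  have "cv.independent (insert w {v}) \<longleftrightarrow> w \<notin> cv.span {v} \<and> cv.independent {v}"
    using False by (subst cv.independent_insert) auto
  then show ?thesis using False by (auto simp: cv.dependent_single insert_commute)
qed

lemma span_pair: "cv.span {v, w} = {cscale a v + cscale b w | a b. True}"
proof -
  have "x \<in> cv.span {v, w} \<longleftrightarrow> (\<exists>a b. x = cscale a v + cscale b w)" for x
  proof -
    have "x \<in> cv.span {v, w} \<longleftrightarrow> (\<exists>k. x - cscale k v \<in> cv.span {w})"
      by (rule cv.span_breakdown_eq)
    also have "\<dots> \<longleftrightarrow> (\<exists>k b. x - cscale k v = cscale b w)" unfolding span_singleton by auto
    also have "\<dots> \<longleftrightarrow> (\<exists>k b. x = cscale k v + cscale b w)" by (metis add.commute diff_eq_eq)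
    finally show ?thesis .
  qed
  then show ?thesis by auto
qed

lemma dim_2_obtain_basis:
  assumes "cv.subspace W" "cv.dim W = 2"
  obtains v w where "v \<noteq> w" "cv.independent {v, w}" "W = cv.span {v, w}"
proof -
  obtain B where B: "B \<subseteq> W" "cv.independent B" "W \<subseteq> cv.span B" "card B = cv.dim W"
    using cv.basis_exists by metis
  then obtain v w where "B = {v, w}" "v \<noteq> w" using assms(2) by (metis card_2_iff)
  moreover have "cv.span B = W" using B assms(1) by (metis cv.span_minimal subset_antisym)
  ultimately show thesis using that B by metis
qed

lemma dim_span_pair: "v \<noteq> w \<Longrightarrow> cv.independent {v, w} \<Longrightarrow> cv.dim (cv.span {v, w}) = 2"
  by (metis card_2_iff cv.dim_eq_card_independent cv.dim_span)

section \<open>Forms\<close>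

lemma finite_exponents: "finite I \<Longrightarrow> finite (exponents I k)"
proof -
  assume I: "finite I"
  have "exponents I k \<subseteq> (\<lambda>f i. if i \<in> I then f i else 0) ` (I \<rightarrow>\<^sub>E {..k})"
  proof
    fix m assume m: "m \<in> exponents I k"
    have "m i \<le> k" if "i \<in> I" for i
    proof -
      have "m i \<le> (\<Sum>i\<in>I. m i)" using that I by (intro member_le_sum) auto
      then show ?thesis using m by (simp add: exponents_def)
    qed
    then have "restrict m I \<in> I \<rightarrow>\<^sub>E {..k}" by auto
    moreover have "m = (\<lambda>i. if i \<in> I then restrict m I i else 0)"
      using m by (auto simp: exponents_def fun_eq_iff)
    ultimately show "m \<in> (\<lambda>f i. if i \<in> I then f i else 0) ` (I \<rightarrow>\<^sub>E {..k})" by blast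
  qed
  moreover have "finite (I \<rightarrow>\<^sub>E {..k})" using I by (intro finite_PiE) auto
  ultimately show ?thesis by (meson finite_imageI finite_subset)
qed

lemma exponents_0: "finite I \<Longrightarrow> exponents I 0 = {\<lambda>_. 0}"
  by (auto simp: exponents_def fun_eq_iff)

lemma exponents_add: "m \<in> exponents I a \<Longrightarrow> m' \<in> exponents I b \<Longrightarrow> (\<lambda>i. m i + m' i) \<in> exponents I (a + b)"
  by (auto simp: exponents_def sum.distrib)

lemma monomial_add: "monomial I (\<lambda>i. m i + m' i) v = monomial I m v * monomial I m' v"
  by (simp add: monomial_def power_add prod.distrib)

lemma exponents_unit: "finite I \<Longrightarrow> i \<in> I \<Longrightarrow> (\<lambda>j. if j = i then k else 0) \<in> exponents I k"
  by (auto simp: exponents_def sum.delta)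

lemma monomial_unit: "finite I \<Longrightarrow> i \<in> I \<Longrightarrow> monomial I (\<lambda>j. if j = i then k else 0) v = v i ^ k"
proof -
  assume I: "finite I" "i \<in> I"
  have "monomial I (\<lambda>j. if j = i then k else 0) v = (\<Prod>j\<in>I. if j = i then v j ^ k else 1)"
    unfolding monomial_def by (intro prod.cong) auto
  also have "\<dots> = v i ^ k" using I by (simp add: prod.delta)
  finally show ?thesis .
qed

lemma monomial_scale: "m \<in> exponents I k \<Longrightarrow> monomial I m (cscale c v) = c ^ k * monomial I m v"
  by (simp add: monomial_def exponents_def power_mult_distrib prod.distrib power_sum [symmetric])

lemma forms_scale_arg:
  assumes "f \<in> forms I k" shows "f (cscale c v) = c ^ k * f v"
  using assms by (auto simp: forms_def sum_distrib_left monomial_scale intro!: sum.cong)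

lemma forms_monomial:
  assumes "finite I" "m \<in> exponents I k" shows "(\<lambda>v. a * monomial I m v) \<in> forms I k"
proof -
  have "(\<lambda>v. a * monomial I m v) =
      (\<lambda>v. \<Sum>m'\<in>exponents I k. (if m' = m then a else 0) * monomial I m' v)"
  proof
    fix v
    have "(\<Sum>m'\<in>exponents I k. (if m' = m then a else 0) * monomial I m' v) =
      (\<Sum>m'\<in>exponents I k. if m' = m then a * monomial I m' v else 0)"
      by (intro sum.cong) auto
    also have "\<dots> = a * monomial I m v"
      using assms finite_exponents[OF assms(1), of k] by (simp add: sum.delta)
    finally show "a * monomial I m v =
      (\<Sum>m'\<in>exponents I k. (if m' = m then a else 0) * monomial I m' v)" ..
  qed
  then show ?thesis
    unfolding forms_def mem_Collect_eq by (intro exI[of _ "\<lambda>m'. if m' = m then a else 0"]) simp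
qed

lemma forms_zero: "(\<lambda>v. 0) \<in> forms I k"
  unfolding forms_def mem_Collect_eq by (rule exI[of _ "\<lambda>_. 0"]) simp

lemma forms_add: "f \<in> forms I k \<Longrightarrow> g \<in> forms I k \<Longrightarrow> (\<lambda>v. f v + g v) \<in> forms I k"
proof -
  assume "f \<in> forms I k" "g \<in> forms I k"
  then obtain c c' where "f = (\<lambda>v. \<Sum>m\<in>exponents I k. c m * monomial I m v)"
    "g = (\<lambda>v. \<Sum>m\<in>exponents I k. c' m * monomial I m v)" unfolding forms_def by blast
  then have "(\<lambda>v. f v + g v) = (\<lambda>v. \<Sum>m\<in>exponents I k. (c m + c' m) * monomial I m v)"
    by (simp add: sum.distrib distrib_right)
  then show ?thesis unfolding forms_def mem_Collect_eq by (intro exI[of _ "\<lambda>m. c m + c' m"]) simp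
qed

lemma forms_cmult: "f \<in> forms I k \<Longrightarrow> (\<lambda>v. a * f v) \<in> forms I k"
proof -
  assume "f \<in> forms I k"
  then obtain c where "f = (\<lambda>v. \<Sum>m\<in>exponents I k. c m * monomial I m v)"
    unfolding forms_def by blast
  then have "(\<lambda>v. a * f v) = (\<lambda>v. \<Sum>m\<in>exponents I k. (a * c m) * monomial I m v)"
    by (simp add: sum_distrib_left mult.assoc)
  then show ?thesis unfolding forms_def mem_Collect_eq by (intro exI[of _ "\<lambda>m. a * c m"]) simp
qed

lemma forms_sum: "(\<And>x. x \<in> A \<Longrightarrow> f x \<in> forms I k) \<Longrightarrow> (\<lambda>v. \<Sum>x\<in>A. f x v) \<in> forms I k"
  by (induction A rule: infinite_finite_induct) (auto intro: forms_zero forms_add)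

text \<open>The zero form needs its own case: when \<open>exponents I k\<close> is empty (no
  variables, positive degree) it is not a multiple of any monomial.\<close>

lemma forms_induct [consumes 2, case_names monomial add]:
  assumes "finite I" "f \<in> forms I k"
    and "\<And>a m. m \<in> exponents I k \<Longrightarrow> P (\<lambda>v. a * monomial I m v)"
    and add: "\<And>f g. f \<in> forms I k \<Longrightarrow> g \<in> forms I k \<Longrightarrow> P f \<Longrightarrow> P g \<Longrightarrow> P (\<lambda>v. f v + g v)"
    and zero: "P (\<lambda>v. 0)"
  shows "P f"
proof -
  obtain c where f: "f = (\<lambda>v. \<Sum>m\<in>exponents I k. c m * monomial I m v)"
    using assms(2) unfolding forms_def by blast
  have "S \<subseteq> exponents I k \<Longrightarrow> P (\<lambda>v. \<Sum>m\<in>S. c m * monomial I m v)" if "finite S" for S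
    using that
  proof (induction S)
    case empty then show ?case using zero by simp
  next
    case (insert m S)
    have "(\<lambda>v. \<Sum>m\<in>S. c m * monomial I m v) \<in> forms I k"
      using insert.prems by (intro forms_sum forms_monomial assms(1)) auto
    then have "P (\<lambda>v. c m * monomial I m v + (\<Sum>m\<in>S. c m * monomial I m v))"
      using insert by (intro add assms(3) forms_monomial assms(1)) auto
    then show ?case using insert by simp
  qed
  then show ?thesis using f finite_exponents[OF assms(1)] by blast
qed

lemma forms_mult:
  assumes I: "finite I" and f: "f \<in> forms I a" and g: "g \<in> forms I b"
  shows "(\<lambda>v. f v * g v) \<in> forms I (a + b)"
  using I f
proof (induction rule: forms_induct)
  case (monomial c m)
  show ?case using I g
  proof (induction rule: forms_induct)
    case (monomial c' m')
    have "(\<lambda>v. c * monomial I m v * (c' * monomial I m' v)) =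
        (\<lambda>v. (c * c') * monomial I (\<lambda>i. m i + m' i) v)" by (simp add: monomial_add mult_ac)
    also have "\<dots> \<in> forms I (a + b)"
      using \<open>m \<in> exponents I a\<close> monomial by (intro forms_monomial I exponents_add)
    finally show ?case .
  next
    case (add f g)
    then show ?case by (auto simp: distrib_left intro: forms_add)
  qed (simp add: forms_zero)
next
  case (add f g)
  then show ?case by (auto simp: distrib_right intro: forms_add)
qed (simp add: forms_zero)

lemma forms_const: "finite I \<Longrightarrow> (\<lambda>v. a) \<in> forms I 0"
  using forms_monomial[of I "\<lambda>_. 0" 0 a] by (simp add: exponents_0 monomial_def)

lemma forms_coord: "finite I \<Longrightarrow> i \<in> I \<Longrightarrow> (\<lambda>v. v i) \<in> forms I 1"
  using forms_monomial[OF _ exponents_unit[of I i 1], of 1] by (simp add: monomial_unit)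

lemma forms_linear: "finite I \<Longrightarrow> (\<lambda>v. \<Sum>i\<in>I. c i * v i) \<in> forms I 1"
  by (intro forms_sum forms_cmult forms_coord)

lemma forms_power: "finite I \<Longrightarrow> f \<in> forms I k \<Longrightarrow> (\<lambda>v. f v ^ r) \<in> forms I (r * k)"
  by (induction r) (auto intro: forms_const forms_mult)

lemma forms_prod:
  assumes "finite I" "finite A" "\<And>x. x \<in> A \<Longrightarrow> f x \<in> forms I (k x)"
  shows "(\<lambda>v. \<Prod>x\<in>A. f x v) \<in> forms I (\<Sum>x\<in>A. k x)"
  using assms(2,3) by (induction A) (auto intro: forms_const[OF assms(1)] forms_mult[OF assms(1)])

lemma vanishes_at_span:
  assumes "f \<in> forms I k" shows "vanishes_at f (cv.span {v}) \<longleftrightarrow> f v = 0"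
  unfolding vanishes_at_def span_singleton
  by (auto simp: forms_scale_arg[OF assms])

text \<open>Along the line each variable becomes a polynomial of degree at most 1 in
  \<open>t\<close>, so a monomial of degree \<open>k\<close> becomes a product of \<open>k\<close>
  of these.\<close>

lemma forms_restrict_line:
  assumes "finite I" "f \<in> forms I k"
  shows "\<exists>p :: complex poly. degree p \<le> k \<and> (\<forall>t. f (v + cscale t w) = poly p t)"
  using assms
proof (induction rule: forms_induct)
  case (monomial a m)
  define p where "p = [:a:] * (\<Prod>i\<in>I. [:v i, w i:] ^ m i)"
  have "degree p \<le> degree (\<Prod>i\<in>I. [:v i, w i:] ^ m i)"
    unfolding p_def using degree_mult_le[of "[:a:]"] by simp
  also have "\<dots> \<le> (\<Sum>i\<in>I. degree ([:v i, w i:] ^ m i))"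
    using degree_prod_sum_le[OF assms(1), of "\<lambda>i. [:v i, w i:] ^ m i"] by (simp add: o_def)
  also have "\<dots> \<le> (\<Sum>i\<in>I. m i)"
  proof (intro sum_mono)
    fix i
    have "degree ([:v i, w i:] ^ m i) \<le> degree [:v i, w i:] * m i" by (rule degree_power_le)
    also have "\<dots> \<le> 1 * m i" by (intro mult_right_mono) auto
    finally show "degree ([:v i, w i:] ^ m i) \<le> m i" by simp
  qed
  finally have "degree p \<le> k" using monomial by (simp add: exponents_def)
  moreover have "a * monomial I m (v + cscale t w) = poly p t" for t
    by (simp add: p_def monomial_def poly_prod mult.commute)
  ultimately show ?case by blast
next
  case (add f g)
  then obtain p q where "degree p \<le> k" "degree q \<le> k" "\<And>t. f (v + cscale t w) = poly p t"
    "\<And>t. g (v + cscale t w) = poly q t" by blast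
  then show ?case by (intro exI[of _ "p + q"]) (simp only: degree_add_le poly_add simp_thms)
qed (intro exI[of _ 0], simp)

section \<open>Partial derivatives of forms\<close>

text \<open>This is the expression occurring in \<open>tangent_cone\<close>, named so that it can be
  folded there.\<close>

definition partial :: "'i \<Rightarrow> (('i \<Rightarrow> complex) \<Rightarrow> complex) \<Rightarrow> ('i \<Rightarrow> complex) \<Rightarrow> complex" where
  "partial i f v = deriv (\<lambda>t. f (v(i := t))) (v i)"

text \<open>Differentiability is encoded as the chain rule along every curve with differentiable
  coordinates. This needs no norm on the function space and yields partial derivatives, directional
  derivatives and composition with the Veronese map alike.\<close>

definition has_gradient ::
  "'i set \<Rightarrow> (('i \<Rightarrow> complex) \<Rightarrow> complex) \<Rightarrow> ('i \<Rightarrow> ('i \<Rightarrow> complex) \<Rightarrow> complex) \<Rightarrow> bool" where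
  "has_gradient I f g \<longleftrightarrow> (\<forall>\<gamma> \<gamma>' t.
     (\<forall>i\<in>I. ((\<lambda>s. \<gamma> s i) has_field_derivative \<gamma>' i) (at t)) \<longrightarrow>
     ((\<lambda>s. f (\<gamma> s)) has_field_derivative (\<Sum>i\<in>I. g i (\<gamma> t) * \<gamma>' i)) (at t))"

lemma has_gradientD:
  assumes "has_gradient I f g" "\<And>i. i \<in> I \<Longrightarrow> ((\<lambda>s. \<gamma> s i) has_field_derivative \<gamma>' i) (at t)"
  shows "((\<lambda>s. f (\<gamma> s)) has_field_derivative (\<Sum>i\<in>I. g i (\<gamma> t) * \<gamma>' i)) (at t)"
  using assms unfolding has_gradient_def by blast

lemma has_gradient_partial:
  assumes I: "finite I" "i \<in> I" and f: "has_gradient I f g"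
  shows "partial i f v = g i v"
proof -
  have "((\<lambda>s. f (v(i := s))) has_field_derivative (\<Sum>j\<in>I. g j (v(i := v i)) * (if j = i then 1 else 0))) (at (v i))"
  proof (rule has_gradientD[OF f])
    fix j assume "j \<in> I"
    show "((\<lambda>s. (v(i := s)) j) has_field_derivative (if j = i then 1 else 0)) (at (v i))"
      by (cases "j = i") auto
  qed
  moreover have "(\<Sum>j\<in>I. g j (v(i := v i)) * (if j = i then 1 else 0)) = g i v"
    using I by (simp add: if_distrib sum.delta cong: if_cong)
  ultimately show ?thesis unfolding partial_def by (simp add: DERIV_imp_deriv)
qed

lemma has_gradient_add:
  "has_gradient I f g \<Longrightarrow> has_gradient I f' g' \<Longrightarrow> has_gradient I (\<lambda>v. f v + f' v) (\<lambda>i v. g i v + g' i v)"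
  unfolding has_gradient_def
  by (auto simp: distrib_right sum.distrib intro!: DERIV_add)

lemma monomial_has_gradient:
  assumes I: "finite I"
  shows "has_gradient I (\<lambda>v. a * monomial I m v)
    (\<lambda>i v. a * of_nat (m i) * monomial I (m(i := m i - 1)) v)"
  unfolding has_gradient_def
proof (intro allI impI)
  fix \<gamma> \<gamma>' t assume *: "\<forall>i\<in>I. ((\<lambda>s. \<gamma> s i) has_field_derivative \<gamma>' i) (at (t::complex))"
  have "((\<lambda>s. \<Prod>i\<in>I. \<gamma> s i ^ m i) has_field_derivative
      (\<Sum>i\<in>I. (of_nat (m i) * (\<gamma>' i * \<gamma> t i ^ (m i - 1))) * (\<Prod>j\<in>I - {i}. \<gamma> t j ^ m j))) (at t)"
    using * by (intro has_field_derivative_prod) (auto intro!: derivative_eq_intros)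
  moreover have "(of_nat (m i) * (\<gamma>' i * \<gamma> t i ^ (m i - 1))) * (\<Prod>j\<in>I - {i}. \<gamma> t j ^ m j) =
     of_nat (m i) * monomial I (m(i := m i - 1)) (\<gamma> t) * \<gamma>' i" if "i \<in> I" for i
  proof -
    have "monomial I (m(i := m i - 1)) (\<gamma> t) =
        \<gamma> t i ^ (m i - 1) * (\<Prod>j\<in>I - {i}. \<gamma> t j ^ (m(i := m i - 1)) j)"
      unfolding monomial_def using I that by (subst prod.remove[of I i]) auto
    also have "(\<Prod>j\<in>I - {i}. \<gamma> t j ^ (m(i := m i - 1)) j) = (\<Prod>j\<in>I - {i}. \<gamma> t j ^ m j)"
      by (intro prod.cong) auto
    finally show ?thesis by (simp only: mult_ac)
  qed
  ultimately have "((\<lambda>s. \<Prod>i\<in>I. \<gamma> s i ^ m i) has_field_derivative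
      (\<Sum>i\<in>I. of_nat (m i) * monomial I (m(i := m i - 1)) (\<gamma> t) * \<gamma>' i)) (at t)"
    by (simp only: cong: sum.cong)
  then have "((\<lambda>s. a * (\<Prod>i\<in>I. \<gamma> s i ^ m i)) has_field_derivative
      a * (\<Sum>i\<in>I. of_nat (m i) * monomial I (m(i := m i - 1)) (\<gamma> t) * \<gamma>' i)) (at t)"
    by (rule DERIV_cmult)
  then show "((\<lambda>s. a * monomial I m (\<gamma> s)) has_field_derivative
      (\<Sum>i\<in>I. a * of_nat (m i) * monomial I (m(i := m i - 1)) (\<gamma> t) * \<gamma>' i)) (at t)"
    by (simp add: monomial_def sum_distrib_left mult.assoc)
qed

lemma form_has_gradient_aux:
  assumes "finite I" "f \<in> forms I k"
  shows "\<exists>g. has_gradient I f g \<and> (\<forall>i\<in>I. g i \<in> forms I (k - 1))"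
  using assms
proof (induction rule: forms_induct)
  case (monomial a m)
  have "(\<lambda>v. a * of_nat (m i) * monomial I (m(i := m i - 1)) v) \<in> forms I (k - 1)" if i: "i \<in> I" for i
  proof (cases "m i = 0")
    \<comment> \<open>Here \<open>m i - 1\<close> truncates and the exponent sum would be wrong, but
      the coefficient \<open>of_nat (m i)\<close> is zero.\<close>
    case True then show ?thesis by (simp add: forms_zero)
  next
    case False
    have "(\<Sum>j\<in>I. m j) = m i + (\<Sum>j\<in>I - {i}. m j)" using assms(1) i by (rule sum.remove)
    moreover have "(\<Sum>j\<in>I. (m(i := m i - 1)) j) = (m i - 1) + (\<Sum>j\<in>I - {i}. (m(i := m i - 1)) j)"
      using assms(1) i by (subst sum.remove[of I i]) auto
    moreover have "(\<Sum>j\<in>I - {i}. (m(i := m i - 1)) j) = (\<Sum>j\<in>I - {i}. m j)"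
      by (intro sum.cong) auto
    ultimately have "m(i := m i - 1) \<in> exponents I (k - 1)"
      using False monomial i unfolding exponents_def by auto
    then show ?thesis using assms(1) by (intro forms_monomial)
  qed
  then show ?case using monomial_has_gradient[OF assms(1), of a m]
    by (intro exI[of _ "\<lambda>i v. a * of_nat (m i) * monomial I (m(i := m i - 1)) v"]) auto
next
  case (add f g)
  then obtain f' g' where *: "has_gradient I f f'" "\<forall>i\<in>I. f' i \<in> forms I (k - 1)"
     "has_gradient I g g'" "\<forall>i\<in>I. g' i \<in> forms I (k - 1)"
    by blast
  show ?case
    using * by (intro exI[of _ "\<lambda>i v. f' i v + g' i v"]) (auto intro: has_gradient_add forms_add)
qed (intro exI[of _ "\<lambda>i v. 0"], auto simp: has_gradient_def forms_zero)

lemma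
  assumes "finite I" "f \<in> forms I k"
  shows form_chain_rule: "(\<And>i. i \<in> I \<Longrightarrow> ((\<lambda>s. \<gamma> s i) has_field_derivative \<gamma>' i) (at t)) \<Longrightarrow>
      ((\<lambda>s. f (\<gamma> s)) has_field_derivative (\<Sum>i\<in>I. partial i f (\<gamma> t) * \<gamma>' i)) (at t)"
    and partial_in_forms: "i \<in> I \<Longrightarrow> partial i f \<in> forms I (k - 1)"
proof -
  obtain g where g: "has_gradient I f g" "\<And>i. i \<in> I \<Longrightarrow> g i \<in> forms I (k - 1)"
    using form_has_gradient_aux[OF assms] by blast
  have p: "partial i f v = g i v" if "i \<in> I" for i v
    using has_gradient_partial[OF assms(1) that g(1)] .
  show "((\<lambda>s. f (\<gamma> s)) has_field_derivative (\<Sum>i\<in>I. partial i f (\<gamma> t) * \<gamma>' i)) (at t)"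
    if "\<And>i. i \<in> I \<Longrightarrow> ((\<lambda>s. \<gamma> s i) has_field_derivative \<gamma>' i) (at t)"
    using has_gradientD[OF g(1) that] by (simp add: p)
  show "partial i f \<in> forms I (k - 1)" if "i \<in> I" using g(2)[OF that] p[OF that] by presburger
qed

definition dir_deriv :: "'i set \<Rightarrow> (('i \<Rightarrow> complex) \<Rightarrow> complex) \<Rightarrow> ('i \<Rightarrow> complex) \<Rightarrow> ('i \<Rightarrow> complex) \<Rightarrow> complex" where
  "dir_deriv I f v u = (\<Sum>i\<in>I. partial i f v * u i)"

lemma dir_deriv_in_forms:
  assumes "finite I" "f \<in> forms I k" shows "(\<lambda>v. dir_deriv I f v u) \<in> forms I (k - 1)"
  unfolding dir_deriv_def mult.commute[of _ "u _"]
  by (intro forms_sum forms_cmult partial_in_forms[OF assms])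

lemma dir_deriv_scale:
  assumes "finite I" "f \<in> forms I k" shows "dir_deriv I f (cscale c v) u = c ^ (k - 1) * dir_deriv I f v u"
  using forms_scale_arg[OF dir_deriv_in_forms[OF assms]] .

lemma has_dir_deriv:
  assumes "finite I" "f \<in> forms I k"
  shows "((\<lambda>t. f (v + cscale t u)) has_field_derivative dir_deriv I f v u) (at 0)"
proof -
  have "((\<lambda>t. f (v + cscale t u)) has_field_derivative (\<Sum>i\<in>I. partial i f (v + cscale 0 u) * u i)) (at 0)"
    by (rule form_chain_rule[OF assms]) (auto intro!: derivative_eq_intros)
  moreover have "v + cscale 0 u = v" by (simp add: fun_eq_iff)
  ultimately show ?thesis by (simp add: dir_deriv_def)
qed

lemma dir_deriv_eqI:
  assumes "finite I" "f \<in> forms I k" "((\<lambda>t. f (v + cscale t u)) has_field_derivative D) (at 0)"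
  shows "dir_deriv I f v u = D"
  using DERIV_unique[OF has_dir_deriv[OF assms(1,2)] assms(3)] .

lemma dir_deriv_add_vec: "dir_deriv I f v (u + u') = dir_deriv I f v u + dir_deriv I f v u'"
  by (simp add: dir_deriv_def distrib_left sum.distrib)

lemma dir_deriv_scale_vec: "dir_deriv I f v (cscale c u) = c * dir_deriv I f v u"
  by (simp add: dir_deriv_def sum_distrib_left mult_ac)

lemma dir_deriv_sum_form:
  assumes "finite I" "\<And>x. x \<in> A \<Longrightarrow> f x \<in> forms I k"
  shows "dir_deriv I (\<lambda>v. \<Sum>x\<in>A. c x * f x v) v u = (\<Sum>x\<in>A. c x * dir_deriv I (f x) v u)"
  using assms
  by (intro dir_deriv_eqI[OF assms(1) forms_sum[of A _ _ k]] DERIV_sum DERIV_cmult has_dir_deriv forms_cmult)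

text \<open>Euler's relation: moving from \<open>v\<close> in the direction \<open>v\<close> only
  rescales, so the form is multiplied by \<open>(1 + t) ^ k\<close>. It shows that a form of
  positive degree is nonsingular wherever it is nonzero.\<close>

lemma dir_deriv_euler:
  assumes "finite I" "f \<in> forms I k" shows "dir_deriv I f v v = of_nat k * f v"
proof (rule dir_deriv_eqI[OF assms])
  have "f (v + cscale t v) = (1 + t) ^ k * f v" for t
  proof -
    have "v + cscale t v = cscale (1 + t) v" by (simp add: fun_eq_iff distrib_right)
    then show ?thesis using forms_scale_arg[OF assms(2)] by simp
  qed
  then show "((\<lambda>t. f (v + cscale t v)) has_field_derivative of_nat k * f v) (at 0)"
    by (auto intro!: derivative_eq_intros)
qed

section \<open>Veronese maps\<close>

lemma veronese_vec_apply: "m \<in> exponents I d \<Longrightarrow> veronese_vec I d v m = monomial I m v"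
  by (simp add: veronese_vec_def)

lemma veronese_vec_in_coord_space: "veronese_vec I d v \<in> coord_space (exponents I d)"
  by (simp add: veronese_vec_def coord_space_def)

lemma veronese_vec_scale: "veronese_vec I d (cscale c v) = cscale (c ^ d) (veronese_vec I d v)"
  by (rule ext) (simp add: veronese_vec_def monomial_scale)

lemma veronese_vec_zero: "d \<ge> 1 \<Longrightarrow> veronese_vec I d 0 = 0"
  using veronese_vec_scale[of I d 0 0] by (simp add: cscale_def zero_fun_def power_0_left)

lemma coord_space_nonzero_coord:
  assumes "v \<in> coord_space I" "v \<noteq> 0" obtains i where "i \<in> I" "v i \<noteq> 0"
  using assms unfolding coord_space_def by (force simp: fun_eq_iff)

lemma veronese_vec_nonzero:
  assumes "finite I" "v \<in> coord_space I" "v \<noteq> 0" shows "veronese_vec I d v \<noteq> 0"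
proof -
  obtain i where i: "i \<in> I" "v i \<noteq> 0" using coord_space_nonzero_coord assms by metis
  let ?m = "\<lambda>j. if j = i then d else 0"
  have "veronese_vec I d v ?m = v i ^ d"
    using i assms(1) by (simp add: veronese_vec_apply exponents_unit monomial_unit)
  then have "veronese_vec I d v ?m \<noteq> 0" using i by simp
  then show ?thesis by (metis zero_fun_apply)
qed

lemma veronese_span: "veronese I d (cv.span {v}) = cv.span {veronese_vec I d v}"
  unfolding veronese_def
proof (rule cv.span_eq[THEN iffD2], intro conjI subsetI)
  fix x assume "x \<in> veronese_vec I d ` cv.span {v}"
  then obtain c where "x = cscale (c ^ d) (veronese_vec I d v)"
    unfolding span_singleton using veronese_vec_scale by blast
  then show "x \<in> cv.span {veronese_vec I d v}" unfolding span_singleton by blast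
next
  fix x assume "x \<in> {veronese_vec I d v}"
  then have "x \<in> veronese_vec I d ` cv.span {v}" by (auto intro: cv.span_base)
  then show "x \<in> cv.span (veronese_vec I d ` cv.span {v})" by (rule cv.span_base)
qed

text \<open>Where the variable \<open>j\<close> is nonzero, these monomials divided by the
  \<open>d\<close>-th power of that variable are the affine coordinates of the point. They suffice
  to recover a point from its Veronese image, and likewise a tangent direction. For
  \<open>i = j\<close> the monomial is the \<open>d\<close>-th power itself.\<close>

lemma exponents_pair:
  assumes "finite I" "i \<in> I" "j \<in> I" "d \<ge> 1"
  defines "b \<equiv> \<lambda>l. (if l = j then d - 1 else 0) + (if l = i then 1 else 0)"
  shows "b \<in> exponents I d" and "monomial I b v = v j ^ (d - 1) * v i"
proof -
  show "b \<in> exponents I d"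
    using exponents_add[OF exponents_unit[of I j "d - 1"] exponents_unit[of I i 1]] assms
    unfolding b_def by auto
  have "monomial I b v = monomial I (\<lambda>l. if l = j then d - 1 else 0) v * monomial I (\<lambda>l. if l = i then 1 else 0) v"
    unfolding b_def by (rule monomial_add)
  then show "monomial I b v = v j ^ (d - 1) * v i" using assms(1-3) by (simp add: monomial_unit)
qed

lemma veronese_inj_span:
  assumes I: "finite I" and d: "d \<ge> 1" and v: "v \<in> coord_space I" "v \<noteq> 0" and w: "w \<in> coord_space I"
    and eq: "cv.span {veronese_vec I d v} = cv.span {veronese_vec I d w}"
  shows "cv.span {v} = cv.span {w}"
proof -
  obtain c where c: "c \<noteq> 0" "veronese_vec I d v = cscale c (veronese_vec I d w)"
    using span_eq_imp_scale[OF eq veronese_vec_nonzero[OF I v]] .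
  have mono: "monomial I m v = c * monomial I m w" if "m \<in> exponents I d" for m
    using fun_cong[OF c(2), of m] that by (simp add: veronese_vec_apply)
  obtain j where j: "j \<in> I" "v j \<noteq> 0" using coord_space_nonzero_coord v by metis
  have vj: "v j ^ d = c * w j ^ d" using mono[OF exponents_unit[OF I j(1)]] by (simp add: monomial_unit[OF I j(1)])
  have wj: "w j \<noteq> 0"
  proof
    assume "w j = 0" then show False using vj j d by (simp add: power_0_left)
  qed
  have "v = cscale (v j / w j) w"
  proof
    fix i
    show "v i = cscale (v j / w j) w i"
    proof (cases "i \<in> I")
      case True
      have "v j ^ (d - 1) * v i = c * (w j ^ (d - 1) * w i)"
        using mono[OF exponents_pair(1)[OF I True j(1) d]] exponents_pair(2)[OF I True j(1) d] by simp
      moreover have "v j ^ (d - 1) * v j = c * (w j ^ (d - 1) * w j)" using vj d by (simp only: power_minus_mult le_less_trans[of 0] zero_less_one order_less_le_trans[of 0 1])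
      \<comment> \<open>Cross-multiplying the two proportionalities eliminates the unknown factor
        \<open>c\<close>; here \<open>p\<close> is \<open>v j ^ (d - 1)\<close> and \<open>q\<close>
        is \<open>w j ^ (d - 1)\<close>.\<close>
      moreover have "p * (b * w') = p * (a * w'')" if "p * b = c * (q * w'')" "p * a = c * (q * w')"
        for p q a b w' w'' :: complex
        using that by algebra
      ultimately have "v j ^ (d - 1) * (v i * w j) = v j ^ (d - 1) * (v j * w i)" by blast
      then have "v i * w j = v j * w i" using j by simp
      then show ?thesis using wj by (simp add: field_simps)
    next
      case False
      then show ?thesis using v w by (simp add: coord_space_def)
    qed
  qed
  then show ?thesis using span_scale_nonzero[of "v j / w j" w] j wj by simp
qed

lemma inj_on_veronese:
  assumes "finite I" "d \<ge> 1" shows "inj_on (veronese I d) (proj_space I)"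
proof (rule inj_onI)
  fix p q assume "p \<in> proj_space I" "q \<in> proj_space I" and eq: "veronese I d p = veronese I d q"
  then obtain v w where *: "v \<in> coord_space I" "v \<noteq> 0" "p = cv.span {v}" "w \<in> coord_space I" "q = cv.span {w}"
    unfolding proj_space_def projectivization_def by blast
  show "p = q" using eq veronese_inj_span[OF assms *(1,2,4)] unfolding *(3,5) veronese_span by blast
qed

lemma veronese_in_proj_space:
  assumes "finite I" "p \<in> proj_space I" shows "veronese I d p \<in> proj_space (exponents I d)"
proof -
  obtain v where v: "v \<in> coord_space I" "v \<noteq> 0" "p = cv.span {v}"
    using assms(2) unfolding proj_space_def projectivization_def by blast
  show ?thesis
    unfolding v(3) veronese_span span_in_proj_space[OF veronese_vec_nonzero[OF assms(1) v(1,2)]]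
    by (rule veronese_vec_in_coord_space)
qed

lemma forms_pullback_veronese:
  assumes I: "finite I" and g: "g \<in> forms (exponents I d) k"
  shows "(\<lambda>v. g (veronese_vec I d v)) \<in> forms I (k * d)"
  using finite_exponents[OF I] g
proof (induction rule: forms_induct)
  case (monomial a m)
  have "(\<lambda>v. a * (\<Prod>e\<in>exponents I d. monomial I e v ^ m e)) \<in> forms I (\<Sum>e\<in>exponents I d. m e * d)"
    using forms_monomial[OF I, of _ d 1]
    by (intro forms_cmult forms_prod forms_power I finite_exponents) auto
  also have "(\<Sum>e\<in>exponents I d. m e * d) = k * d"
    using monomial by (simp add: exponents_def sum_distrib_right[symmetric])
  finally show ?case by (simp add: monomial_def veronese_vec_def)
next
  case (add f g)
  show ?case using add.IH by (rule forms_add)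
qed (rule forms_zero)

text \<open>Variables are moved one at a time from \<open>m\<close> into the first factor. Iterated,
  this cuts a monomial of degree \<open>k * d\<close> into \<open>k\<close> monomials of degree
  \<open>d\<close>, that is, into coordinates of the Veronese target.\<close>

lemma exponents_split:
  assumes I: "finite I" shows "m \<in> exponents I (a + b) \<Longrightarrow>
    \<exists>m1\<in>exponents I a. \<exists>m2\<in>exponents I b. m = (\<lambda>i. m1 i + m2 i)"
proof (induction a arbitrary: m)
  case 0
  then show ?case using I by (simp add: exponents_0)
next
  case (Suc a)
  have "(\<Sum>i\<in>I. m i) \<noteq> 0" using Suc.prems by (simp add: exponents_def)
  then obtain i where i: "i \<in> I" "m i > 0" by (metis not_gr_zero sum.neutral)
  define m' where "m' = m(i := m i - 1)"
  have m: "m = (\<lambda>l. m' l + (if l = i then 1 else 0))" using i by (auto simp: m'_def fun_eq_iff)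
  have "(\<Sum>l\<in>I. m l) = (\<Sum>l\<in>I. m' l) + (\<Sum>l\<in>I. if l = i then 1 else 0)"
    by (subst m) (simp add: sum.distrib)
  then have "m' \<in> exponents I (a + b)"
    using Suc.prems i I by (auto simp: exponents_def m'_def sum.delta)
  then obtain m1 m2 where *: "m1 \<in> exponents I a" "m2 \<in> exponents I b" "m' = (\<lambda>i. m1 i + m2 i)"
    using Suc.IH by blast
  have "(\<lambda>l. m1 l + (if l = i then 1 else 0)) \<in> exponents I (Suc a)"
    using exponents_add[OF *(1) exponents_unit[OF I i(1), of 1]] by simp
  moreover have "m = (\<lambda>l. (m1 l + (if l = i then 1 else 0)) + m2 l)" unfolding m *(3) by auto
  ultimately show ?case using *(2) by (intro bexI)
qed

text \<open>The converse of the pullback, possible only in degrees divisible by \<open>d\<close>. It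
  is what makes the inverse of the Veronese map continuous.\<close>

lemma forms_pushforward_veronese:
  assumes I: "finite I" and f: "f \<in> forms I (k * d)"
  obtains g where "g \<in> forms (exponents I d) k" "\<And>v. g (veronese_vec I d v) = f v"
proof -
  note J = finite_exponents[OF I]
  have mono: "\<exists>g\<in>forms (exponents I d) k. \<forall>v. g (veronese_vec I d v) = monomial I m v"
    if "m \<in> exponents I (k * d)" for m k
    using that
  proof (induction k arbitrary: m)
    case 0
    then show ?case using I J by (intro bexI[of _ "\<lambda>_. 1"] forms_const) (auto simp: exponents_0 monomial_def)
  next
    case (Suc k)
    then obtain m1 m2 where m: "m1 \<in> exponents I d" "m2 \<in> exponents I (k * d)" "m = (\<lambda>i. m1 i + m2 i)"
      using exponents_split[OF I, of m d "k * d"] by auto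
    obtain g where g: "g \<in> forms (exponents I d) k" "\<And>v. g (veronese_vec I d v) = monomial I m2 v"
      using Suc.IH[OF m(2)] by blast
    have "(\<lambda>z. z m1 * g z) \<in> forms (exponents I d) (1 + k)"
      using forms_mult[OF J forms_coord[OF J m(1)] g(1)] .
    then show ?case using m g
      by (intro bexI[of _ "\<lambda>z. z m1 * g z"]) (auto simp: monomial_add veronese_vec_apply)
  qed
  have "\<exists>g\<in>forms (exponents I d) k. \<forall>v. g (veronese_vec I d v) = f v"
    using I f
  proof (induction rule: forms_induct)
    case (monomial a m)
    then obtain g where "g \<in> forms (exponents I d) k" "\<forall>v. g (veronese_vec I d v) = monomial I m v"
      using mono by blast
    then show ?case by (intro bexI[of _ "\<lambda>z. a * g z"] forms_cmult) auto
  next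
    case (add f f')
    then obtain g g' where "g \<in> forms (exponents I d) k" "\<forall>v. g (veronese_vec I d v) = f v"
      "g' \<in> forms (exponents I d) k" "\<forall>v. g' (veronese_vec I d v) = f' v" by blast
    then show ?case by (intro bexI[of _ "\<lambda>z. g z + g' z"] forms_add) auto
  next
    show "\<exists>g\<in>forms (exponents I d) k. \<forall>v. g (veronese_vec I d v) = 0"
      by (intro bexI[of _ "\<lambda>_. 0"] forms_zero) auto
  qed
  then show thesis using that by blast
qed

section \<open>Tangent spaces of Veronese varieties\<close>

text \<open>The differential of \<open>veronese_vec\<close> at \<open>v\<close>, applied to
  \<open>u\<close>. Its image will turn out to be the affine cone over the tangent space.\<close>

definition veronese_deriv ::
  "'i set \<Rightarrow> nat \<Rightarrow> ('i \<Rightarrow> complex) \<Rightarrow> ('i \<Rightarrow> complex) \<Rightarrow> ('i \<Rightarrow> nat) \<Rightarrow> complex" where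
  "veronese_deriv I d v u = (\<lambda>m. if m \<in> exponents I d then dir_deriv I (monomial I m) v u else 0)"

lemma monomial_in_forms: "finite I \<Longrightarrow> m \<in> exponents I k \<Longrightarrow> monomial I m \<in> forms I k"
  using forms_monomial[of I m k 1] by simp

lemma linear_veronese_deriv: "Vector_Spaces.linear cscale cscale (veronese_deriv I d v)"
  by (intro linear_cscaleI) (auto simp: veronese_deriv_def fun_eq_iff dir_deriv_add_vec dir_deriv_scale_vec)

lemma veronese_deriv_in_coord_space: "veronese_deriv I d v u \<in> coord_space (exponents I d)"
  by (simp add: veronese_deriv_def coord_space_def)

lemma dir_deriv_pullback_veronese:
  assumes I: "finite I" and g: "g \<in> forms (exponents I d) k"
  shows "dir_deriv I (\<lambda>v. g (veronese_vec I d v)) v u =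
    dir_deriv (exponents I d) g (veronese_vec I d v) (veronese_deriv I d v u)"
proof (rule dir_deriv_eqI[OF I forms_pullback_veronese[OF I g]])
  have *: "((\<lambda>t. g (veronese_vec I d (v + cscale t u))) has_field_derivative
     (\<Sum>m\<in>exponents I d. partial m g (veronese_vec I d (v + cscale 0 u)) * veronese_deriv I d v u m)) (at 0)"
  proof (rule form_chain_rule[OF finite_exponents[OF I] g])
    fix m assume m: "m \<in> exponents I d"
    then show "((\<lambda>s. veronese_vec I d (v + cscale s u) m) has_field_derivative veronese_deriv I d v u m) (at 0)"
      using has_dir_deriv[OF I monomial_in_forms[OF I m]] by (simp only: veronese_vec_apply veronese_deriv_def if_True)
  qed
  have "v + cscale 0 u = v" by (simp add: fun_eq_iff)
  then show "((\<lambda>t. g (veronese_vec I d (v + cscale t u))) has_field_derivative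
      dir_deriv (exponents I d) g (veronese_vec I d v) (veronese_deriv I d v u)) (at 0)"
    using * by (simp only: dir_deriv_def)
qed

lemma veronese_deriv_unit:
  assumes "finite I" "j \<in> I"
  shows "veronese_deriv I d v u (\<lambda>l. if l = j then d else 0) = of_nat d * v j ^ (d - 1) * u j"
proof -
  have m: "(\<lambda>l. if l = j then d else 0) \<in> exponents I d" using exponents_unit assms by metis
  have "dir_deriv I (monomial I (\<lambda>l. if l = j then d else 0)) v u = of_nat d * v j ^ (d - 1) * u j"
    using monomial_in_forms[OF assms(1) m] monomial_unit[OF assms, of d]
    by (intro dir_deriv_eqI[OF assms(1)]) (auto intro!: derivative_eq_intros)
  then show ?thesis using m by (simp add: veronese_deriv_def)
qed

text \<open>The product rule. For \<open>d = 1\<close> the exponent \<open>d - 2\<close> truncates,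
  but then the factor \<open>of_nat (d - 1)\<close> is zero.\<close>

lemma veronese_deriv_pair:
  assumes "finite I" "i \<in> I" "j \<in> I" "d \<ge> 1"
  shows "veronese_deriv I d v u (\<lambda>l. (if l = j then d - 1 else 0) + (if l = i then 1 else 0)) =
    of_nat (d - 1) * v j ^ (d - 2) * u j * v i + v j ^ (d - 1) * u i"
proof -
  note m = exponents_pair[OF assms]
  have "dir_deriv I (monomial I (\<lambda>l. (if l = j then d - 1 else 0) + (if l = i then 1 else 0))) v u =
      of_nat (d - 1) * v j ^ (d - 2) * u j * v i + v j ^ (d - 1) * u i"
  proof (intro dir_deriv_eqI[OF assms(1) monomial_in_forms[OF assms(1) m(1)]])
    have "((\<lambda>t. (v j + t * u j) ^ (d - 1) * (v i + t * u i)) has_field_derivative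
       of_nat (d - 1) * v j ^ (d - 2) * u j * v i + v j ^ (d - 1) * u i) (at 0)"
      by (auto intro!: derivative_eq_intros simp: diff_diff_left numeral_2_eq_2)
    then show "((\<lambda>t. monomial I (\<lambda>l. (if l = j then d - 1 else 0) + (if l = i then 1 else 0)) (v + cscale t u))
       has_field_derivative of_nat (d - 1) * v j ^ (d - 2) * u j * v i + v j ^ (d - 1) * u i) (at 0)"
      by (simp only: m(2) plus_fun_apply cscale_apply)
  qed
  then show ?thesis using m(1) by (simp add: veronese_deriv_def)
qed

text \<open>The system is triangular: where \<open>v j\<close> is nonzero, the coordinate at the
  \<open>d\<close>-th power of the variable \<open>j\<close> determines \<open>u j\<close>, and then
  the coordinates from \<open>exponents_pair\<close> determine every \<open>u i\<close>.\<close>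

lemma inj_on_veronese_deriv:
  assumes I: "finite I" and d: "d \<ge> 1" and v: "v \<in> coord_space I" "v \<noteq> 0"
  shows "inj_on (veronese_deriv I d v) (coord_space I)"
proof (rule inj_onI)
  fix u u' assume u: "u \<in> coord_space I" "u' \<in> coord_space I"
    and eq: "veronese_deriv I d v u = veronese_deriv I d v u'"
  obtain j where j: "j \<in> I" "v j \<noteq> 0" using coord_space_nonzero_coord v by metis
  have uj: "u j = u' j"
    using fun_cong[OF eq, of "\<lambda>l. if l = j then d else 0"] j d by (simp add: veronese_deriv_unit[OF I j(1)])
  show "u = u'"
  proof
    fix i
    show "u i = u' i"
    proof (cases "i \<in> I")
      case True
      then show ?thesis
        using fun_cong[OF eq, of "\<lambda>l. (if l = j then d - 1 else 0) + (if l = i then 1 else 0)"] j uj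
        unfolding veronese_deriv_pair[OF I True j(1) d] by simp
    qed (use u in \<open>simp add: coord_space_def\<close>)
  qed
qed

lemma tangent_cone_eq:
  "tangent_cone I X p = {w \<in> coord_space I. \<forall>k. \<forall>f\<in>forms I k. (\<forall>q\<in>X. vanishes_at f q) \<longrightarrow>
       (\<forall>v\<in>p. dir_deriv I f v w = 0)}"
  unfolding tangent_cone_def dir_deriv_def partial_def ..

lemma subspace_tangent_cone: "cv.subspace (tangent_cone I X p)"
  unfolding tangent_cone_eq cv.subspace_def
  by (auto simp: coord_space_def dir_deriv_add_vec dir_deriv_scale_vec simp del: plus_fun_apply)
    (auto simp: dir_deriv_def coord_space_def)

text \<open>A form vanishing on all of projective space is constantly zero along every line inside
  the coordinate space, so its directional derivatives vanish and impose no condition.\<close>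

lemma tangent_cone_proj_space:
  assumes I: "finite I" and p: "p \<in> proj_space I"
  shows "tangent_cone I (proj_space I) p = coord_space I"
proof -
  have "dir_deriv I f v u = 0"
    if f: "f \<in> forms I k" "\<forall>q\<in>proj_space I. vanishes_at f q" and v: "v \<in> p" and u: "u \<in> coord_space I"
    for f k v u
  proof -
    obtain x where x: "x \<in> coord_space I" "x \<noteq> 0" "p = cv.span {x}"
      using p unfolding proj_space_def projectivization_def by blast
    have vc: "v \<in> coord_space I" using v x by (auto simp: span_singleton intro: coord_space_scale)
    have "f y = 0" if y: "y \<in> coord_space I" for y
    proof (cases "y = 0")
      case True
      then show ?thesis using f(2) p x(3) cv.span_zero unfolding vanishes_at_def by blast
    next
      case False
      then have "vanishes_at f (cv.span {y})" using f(2) y by (simp add: span_in_proj_space)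
      then show ?thesis using vanishes_at_span[OF f(1)] by blast
    qed
    then have "((\<lambda>t. f (v + cscale t u)) has_field_derivative 0) (at 0)"
      using coord_space_add[OF vc coord_space_scale[OF u]] by simp
    then show ?thesis by (rule dir_deriv_eqI[OF I f(1)])
  qed
  then show ?thesis unfolding tangent_cone_eq by blast
qed

text \<open>Images of the differential are tangent because a form vanishing on the variety is
  identically zero along \<open>veronese_vec I d (x + cscale t u)\<close>. Conversely, some
  \<open>u\<close> reproduces the coordinates of a tangent vector at \<open>?a\<close> and all
  \<open>?b i\<close>; the difference is tangent with these coordinates zero, which forces it to be
  zero.\<close>

lemma tangent_cone_veronese:
  assumes I: "finite I" and d: "d \<ge> 1" and x: "x \<in> coord_space I" "x \<noteq> 0"
  shows "tangent_cone (exponents I d) (veronese I d ` proj_space I) (cv.span {veronese_vec I d x}) =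
    veronese_deriv I d x ` coord_space I" (is "?T = _")
proof
  note J = finite_exponents[OF I, of d]
  have "dir_deriv (exponents I d) g z (veronese_deriv I d x u) = 0"
    if g: "g \<in> forms (exponents I d) k" "\<forall>q\<in>veronese I d ` proj_space I. vanishes_at g q"
      and z: "z \<in> cv.span {veronese_vec I d x}" and u: "u \<in> coord_space I" for g k z u
  proof -
    have g0: "g (veronese_vec I d y) = 0" if y: "y \<in> coord_space I" for y
    proof (cases "y = 0")
      case True
      then have "veronese_vec I d y \<in> cv.span {veronese_vec I d x}"
        using d by (simp add: veronese_vec_zero cv.span_zero)
      moreover have "vanishes_at g (cv.span {veronese_vec I d x})"
        using g(2) x by (metis imageI span_in_proj_space veronese_span)
      ultimately show ?thesis unfolding vanishes_at_def by blast
    next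
      case False
      then have "vanishes_at g (cv.span {veronese_vec I d y})"
        using g(2) y by (metis imageI span_in_proj_space veronese_span)
      then show ?thesis using vanishes_at_span[OF g(1)] by blast
    qed
    have "((\<lambda>t. g (veronese_vec I d (x + cscale t u))) has_field_derivative 0) (at 0)"
      using g0 coord_space_add[OF x(1) coord_space_scale[OF u]] by simp
    then have "dir_deriv I (\<lambda>v. g (veronese_vec I d v)) x u = 0"
      by (rule dir_deriv_eqI[OF I forms_pullback_veronese[OF I g(1)]])
    then have "dir_deriv (exponents I d) g (veronese_vec I d x) (veronese_deriv I d x u) = 0"
      by (simp add: dir_deriv_pullback_veronese[OF I g(1)])
    moreover obtain c where "z = cscale c (veronese_vec I d x)" using z unfolding span_singleton by blast
    ultimately show ?thesis by (simp add: dir_deriv_scale[OF J g(1)])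
  qed
  then show sup: "veronese_deriv I d x ` coord_space I \<subseteq> ?T"
    unfolding tangent_cone_eq by (auto simp: veronese_deriv_in_coord_space)
  obtain j where j: "j \<in> I" "x j \<noteq> 0" using coord_space_nonzero_coord x by metis
  let ?a = "\<lambda>l. if l = j then d else 0"
  let ?b = "\<lambda>i l. (if l = j then d - 1 else 0) + (if l = i then 1 else 0)"
  have a: "?a \<in> exponents I d" using exponents_unit[OF I j(1)] .
  have b: "?b i \<in> exponents I d" if "i \<in> I" for i using exponents_pair(1)[OF I that j(1) d] .
  \<comment> \<open>The quadrics \<open>z m * z a - z m' * z (b i)\<close> with \<open>m + a = m' + b i\<close> vanish on the Veronese variety and
    determine a tangent vector by its coordinates at \<open>a\<close> and at the \<open>b i\<close>, by descending induction on the
    exponent of the variable \<open>j\<close> in \<open>m\<close>.\<close>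
  have vanish: "w m = 0"
    if w: "w \<in> ?T" "w ?a = 0" "\<And>i. i \<in> I \<Longrightarrow> w (?b i) = 0" and m: "m \<in> exponents I d" for w m
    using m
  proof (induction "d - m j" arbitrary: m rule: less_induct)
    case less
    have msum: "(\<Sum>l\<in>I. m l) = d" using less.prems by (simp add: exponents_def)
    have split: "(\<Sum>l\<in>I. m l) = m j + (\<Sum>l\<in>I - {j}. m l)" using I j by (simp add: sum.remove)
    show ?case
    proof (cases "\<exists>i\<in>I - {j}. m i > 0")
      case False
      then have "m j = d" using msum split by simp
      then have "m = ?a" using less.prems False by (auto simp: exponents_def fun_eq_iff)
      then show ?thesis using w(2) by simp
    next
      case True
      then obtain i where i: "i \<in> I" "i \<noteq> j" "m i > 0" by auto
      define m' where "m' = m(i := m i - 1, j := m j + 1)"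
      have rel: "(\<lambda>l. m l + ?a l) = (\<lambda>l. m' l + ?b i l)" using i d by (auto simp: m'_def fun_eq_iff)
      have "(\<Sum>l\<in>I. m l + ?a l) = (\<Sum>l\<in>I. m' l + ?b i l)" unfolding rel ..
      then have "(\<Sum>l\<in>I. m l) + (\<Sum>l\<in>I. ?a l) = (\<Sum>l\<in>I. m' l) + (\<Sum>l\<in>I. ?b i l)"
        by (simp only: sum.distrib)
      moreover have "(\<Sum>l\<in>I. ?a l) = d" "(\<Sum>l\<in>I. ?b i l) = d"
        using a b[OF i(1)] unfolding exponents_def by blast+
      ultimately have "(\<Sum>l\<in>I. m' l) = d" using msum by simp
      then have m': "m' \<in> exponents I d"
        using less.prems i j by (simp add: exponents_def m'_def)
      have "m i \<le> (\<Sum>l\<in>I - {j}. m l)" using i I by (intro member_le_sum) auto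
      then have "m j < d" using msum split i by linarith
      then have "w m' = 0" using i by (intro less.hyps[OF _ m']) (simp add: m'_def)
      define g where "g z = z m * z ?a - z m' * z (?b i)" for z :: "('a \<Rightarrow> nat) \<Rightarrow> complex"
      have "(\<lambda>z. z m * z ?a + (- 1) * (z m' * z (?b i))) \<in> forms (exponents I d) (1 + 1)"
        using less.prems a m' b[OF i(1)] by (intro forms_add forms_cmult forms_mult J forms_coord)
      then have g: "g \<in> forms (exponents I d) (1 + 1)" unfolding g_def by simp
      have "g (veronese_vec I d y) = 0" for y
      proof -
        have "monomial I m y * monomial I ?a y = monomial I m' y * monomial I (?b i) y"
          unfolding monomial_add[symmetric] rel ..
        then show ?thesis unfolding g_def using less.prems a m' b[OF i(1)]
          by (simp only: veronese_vec_apply diff_self)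
      qed
      then have "\<forall>q\<in>veronese I d ` proj_space I. vanishes_at g q"
        by (auto simp: proj_space_def projectivization_def veronese_span vanishes_at_span[OF g])
      moreover have "veronese_vec I d x \<in> cv.span {veronese_vec I d x}" by (simp add: cv.span_base)
      ultimately have "dir_deriv (exponents I d) g (veronese_vec I d x) w = 0"
        using w(1) g unfolding tangent_cone_eq by blast
      moreover have "dir_deriv (exponents I d) g (veronese_vec I d x) w =
          w m * veronese_vec I d x ?a + w ?a * veronese_vec I d x m
           - (w m' * veronese_vec I d x (?b i) + w (?b i) * veronese_vec I d x m')"
        unfolding g_def
        by (rule dir_deriv_eqI[OF J g[unfolded g_def]])
          (auto intro!: derivative_eq_intros simp del: One_nat_def)
      \<comment> \<open>Of the four terms of the derivative, three contain a coordinate of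
        \<open>w\<close> already known to vanish.\<close>
      ultimately have "w m * veronese_vec I d x ?a = 0" using \<open>w m' = 0\<close> w(2) w(3)[OF i(1)] by simp
      moreover have "veronese_vec I d x ?a = x j ^ d"
        using a by (simp only: veronese_vec_apply monomial_unit[OF I j(1)])
      ultimately show ?thesis using j by simp
    qed
  qed
  show "?T \<subseteq> veronese_deriv I d x ` coord_space I"
  proof
    fix w assume w: "w \<in> ?T"
    \<comment> \<open>Obtained by solving \<open>veronese_deriv_unit\<close> for \<open>u j\<close>,
      then \<open>veronese_deriv_pair\<close> for the remaining \<open>u i\<close>.\<close>
    define uj where "uj = w ?a / (of_nat d * x j ^ (d - 1))"
    define u where "u i = (if i = j then uj else if i \<in> I then
      (w (?b i) - of_nat (d - 1) * x j ^ (d - 2) * uj * x i) / x j ^ (d - 1) else 0)" for i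
    have u: "u \<in> coord_space I" using j by (simp add: u_def coord_space_def)
    let ?w = "w - veronese_deriv I d x u"
    have T: "?w \<in> ?T" using w sup u cv.subspace_diff[OF subspace_tangent_cone] by blast
    have wa: "?w ?a = 0"
      unfolding fun_diff_def veronese_deriv_unit[OF I j(1)] using j d by (simp add: u_def uj_def)
    have "?w (?b i) = 0" if i: "i \<in> I" for i
    proof (cases "i = j")
      case True
      have "?b i = ?a" using True d by (auto simp: fun_eq_iff)
      then show ?thesis using wa by (simp only:)
    next
      case False
      then show ?thesis
        unfolding fun_diff_def veronese_deriv_pair[OF I i j(1) d] using j i by (simp add: u_def)
    qed
    then have "?w m = 0" if "m \<in> exponents I d" for m using vanish[OF T wa _ that] by blast
    moreover have "w \<in> coord_space (exponents I d)" using w unfolding tangent_cone_eq by blast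
    ultimately have "w = veronese_deriv I d x u"
      using veronese_deriv_in_coord_space[of I d x u] by (force simp: coord_space_def)
    then show "w \<in> veronese_deriv I d x ` coord_space I" using u by blast
  qed
qed

lemma dim_tangent_cone_veronese:
  assumes "finite I" "d \<ge> 1" "p \<in> proj_space I"
  shows "cv.dim (tangent_cone (exponents I d) (veronese I d ` proj_space I) (veronese I d p)) =
    cv.dim (coord_space I)"
proof -
  obtain x where x: "x \<in> coord_space I" "x \<noteq> 0" "p = cv.span {x}"
    using assms(3) unfolding proj_space_def projectivization_def by blast
  show ?thesis
    unfolding x(3) veronese_span tangent_cone_veronese[OF assms(1,2) x(1,2)]
    by (intro dim_image_inj linear_veronese_deriv subspace_coord_space inj_on_veronese_deriv assms(1,2) x)
qed

text \<open>In positive degree, for \<open>x\<close> in the coordinate space, the vanishing of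
  \<open>F\<close> at \<open>x\<close> itself is implied by Euler's relation.\<close>

definition singular_form :: "'i set \<Rightarrow> (('i \<Rightarrow> complex) \<Rightarrow> complex) \<Rightarrow> ('i \<Rightarrow> complex) \<Rightarrow> bool" where
  "singular_form I F x \<longleftrightarrow> (\<forall>u\<in>coord_space I. dir_deriv I F x u = 0)"

text \<open>A hyperplane with coefficients \<open>c\<close> cuts out the form with the same
  coefficients, and evaluating it on a tangent vector differentiates that form
  (\<open>pair\<close>). So it contains the tangent space at \<open>x\<close> iff the form is
  singular at \<open>x\<close>. A tangent vector outside the span is separated from it by a
  hyperplane, whose form violates the right-hand side.\<close>

lemma veronese_deriv_subset_span_iff:
  assumes I: "finite I"
  shows "veronese_deriv I d q ` coord_space I \<subseteq> cv.span (\<Union>x\<in>S. veronese_deriv I d x ` coord_space I) \<longleftrightarrow>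
    (\<forall>F\<in>forms I d. (\<forall>x\<in>S. singular_form I F x) \<longrightarrow> singular_form I F q)" (is "?L \<longleftrightarrow> ?R")
proof -
  note J = finite_exponents[OF I, of d]
  let ?W = "cv.span (\<Union>x\<in>S. veronese_deriv I d x ` coord_space I)"
  let ?F = "\<lambda>c v. \<Sum>m\<in>exponents I d. c m * monomial I m v"
  have F: "?F c \<in> forms I d" for c by (intro forms_sum forms_monomial I)
  have pair: "(\<Sum>m\<in>exponents I d. c m * veronese_deriv I d x u m) = dir_deriv I (?F c) x u" for c x u
    using dir_deriv_sum_form[OF I, of "exponents I d" "monomial I" d c x u] monomial_in_forms[OF I]
    by (simp add: veronese_deriv_def)
  have W: "?W \<subseteq> coord_space (exponents I d)"
    by (intro cv.span_minimal subspace_coord_space) (auto simp: veronese_deriv_in_coord_space)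
  show ?thesis
  proof
    assume L: ?L
    show ?R
    proof (intro ballI impI)
      fix F assume "F \<in> forms I d" and sing: "\<forall>x\<in>S. singular_form I F x"
      then obtain c where c: "F = ?F c" unfolding forms_def by blast
      have sub: "cv.subspace {w. (\<Sum>m\<in>exponents I d. c m * w m) = 0}"
        unfolding cv.subspace_def
        by (auto simp: distrib_left sum.distrib mult.left_commute[of "c _"] sum_distrib_left[symmetric])
      have "?W \<subseteq> {w. (\<Sum>m\<in>exponents I d. c m * w m) = 0}"
        using sing by (intro cv.span_minimal sub) (auto simp: pair c singular_form_def)
      then show "singular_form I F q" using L unfolding singular_form_def c pair[symmetric] by blast
    qed
  next
    assume R: ?R
    show ?L
    proof (rule ccontr)
      assume "\<not> ?L"
      then obtain u where u: "u \<in> coord_space I" "veronese_deriv I d q u \<notin> ?W" by blast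
      obtain c where c: "\<And>w. w \<in> ?W \<Longrightarrow> (\<Sum>m\<in>exponents I d. c m * w m) = 0"
        "(\<Sum>m\<in>exponents I d. c m * veronese_deriv I d q u m) \<noteq> 0"
        using separating_functional[OF J cv.subspace_span W veronese_deriv_in_coord_space u(2)] by blast
      have "singular_form I (?F c) x" if "x \<in> S" for x
        unfolding singular_form_def pair[symmetric] using that by (auto intro!: c(1) cv.span_base)
      then show False using R F u(1) c(2) unfolding singular_form_def pair by blast
    qed
  qed
qed

section \<open>Krull dimension\<close>

lemma irreducible_in_homeomorphic_image:
  assumes f: "homeomorphic_map T T' f" and Z: "irreducible_in T Z"
  shows "irreducible_in T' (f ` Z)"
  unfolding irreducible_in_def
proof (intro conjI allI impI)
  have cont: "continuous_map T T' f" using f by (rule homeomorphic_imp_continuous_map)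
  have ZT: "Z \<noteq> {}" "Z \<subseteq> topspace T" using Z unfolding irreducible_in_def by auto
  show "f ` Z \<noteq> {}" using ZT by simp
  show "f ` Z \<subseteq> topspace T'" using ZT homeomorphic_imp_surjective_map[OF f] by blast
  fix F G assume FG: "closedin T' F \<and> closedin T' G \<and> f ` Z \<subseteq> F \<union> G"
  let ?F = "{x \<in> topspace T. f x \<in> F}" and ?G = "{x \<in> topspace T. f x \<in> G}"
  have "closedin T ?F" "closedin T ?G" "Z \<subseteq> ?F \<union> ?G"
    using FG ZT closedin_continuous_map_preimage[OF cont] by auto
  then have "Z \<subseteq> ?F \<or> Z \<subseteq> ?G" using Z unfolding irreducible_in_def by blast
  then show "f ` Z \<subseteq> F \<or> f ` Z \<subseteq> G" by blast
qed

lemma krull_dim_le_homeomorphic: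
  assumes f: "homeomorphic_map T T' f" shows "krull_dim T \<le> krull_dim T'"
  unfolding krull_dim_def
proof (rule Sup_subset_mono, rule subsetI)
  fix x
  assume "x \<in> {enat k | k. \<exists>Z. (\<forall>i\<le>k. closedin T (Z i) \<and> irreducible_in T (Z i)) \<and>
     (\<forall>i<k. Z i \<subset> Z (Suc i))}"
  then obtain k Z where Z: "x = enat k" "\<And>i. i \<le> k \<Longrightarrow> closedin T (Z i)"
    "\<And>i. i \<le> k \<Longrightarrow> irreducible_in T (Z i)" "\<And>i. i < k \<Longrightarrow> Z i \<subset> Z (Suc i)" by blast
  have inj: "inj_on f (topspace T)" using f by (rule homeomorphic_imp_injective_map)
  have "closedin T' (f ` Z i)" if "i \<le> k" for i
    using Z(2)[OF that] homeomorphic_map_closedness_eq[OF f] by blast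
  moreover have "f ` Z i \<subset> f ` Z (Suc i)" if "i < k" for i
  proof -
    have "Z i \<subseteq> topspace T" "Z (Suc i) \<subseteq> topspace T"
      using Z(2)[of i] Z(2)[of "Suc i"] that by (simp_all add: closedin_subset)
    then show ?thesis using Z(4)[OF that] inj inj_on_image_eq_iff[OF inj] by blast
  qed
  ultimately show "x \<in> {enat k | k. \<exists>Z. (\<forall>i\<le>k. closedin T' (Z i) \<and> irreducible_in T' (Z i)) \<and>
     (\<forall>i<k. Z i \<subset> Z (Suc i))}"
    unfolding mem_Collect_eq using Z(1) irreducible_in_homeomorphic_image[OF f Z(3)]
    by (intro exI[of _ k] exI[of _ "\<lambda>i. f ` Z i"] conjI allI impI)
qed

lemma krull_dim_homeomorphic:
  assumes "homeomorphic_map T T' f" shows "krull_dim T = krull_dim T'"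
proof -
  obtain g where "homeomorphic_maps T T' f g" using assms unfolding homeomorphic_map_maps by blast
  then have "homeomorphic_map T' T g" by (simp add: homeomorphic_maps_map)
  then show ?thesis using assms krull_dim_le_homeomorphic by (metis antisym)
qed

text \<open>In a finite T1 space every subset is closed, so an irreducible set with two points would
  split into one point and the rest. Chains therefore have length 0.\<close>

lemma krull_dim_finite_t1:
  assumes t1: "t1_space T" and fin: "finite (topspace T)" shows "krull_dim T = 0"
proof -
  have sing: "\<exists>z. Z = {z}" if Z: "irreducible_in T Z" for Z
  proof -
    have sub: "Z \<subseteq> topspace T" and ne: "Z \<noteq> {}" using Z unfolding irreducible_in_def by auto
    then obtain z where z: "z \<in> Z" by blast
    have "finite Z" using fin sub by (rule finite_subset[rotated])
    then have "closedin T {z}" "closedin T (Z - {z})"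
      using t1[unfolded t1_space_closedin_finite] sub z by auto
    moreover have "Z \<subseteq> {z} \<union> (Z - {z})" by blast
    ultimately have "Z \<subseteq> {z} \<or> Z \<subseteq> Z - {z}" using Z unfolding irreducible_in_def by blast
    then show ?thesis using z by blast
  qed
  have "k = 0" if Z: "\<And>i. i \<le> k \<Longrightarrow> irreducible_in T (Z i)" "\<And>i. i < k \<Longrightarrow> Z i \<subset> Z (Suc i)" for k Z
  proof (rule ccontr)
    assume "k \<noteq> 0"
    then have 1: "Z 0 \<subset> Z (Suc 0)" "irreducible_in T (Z 0)" "irreducible_in T (Z (Suc 0))"
      using Z by simp_all
    obtain y z where "Z 0 = {y}" "Z (Suc 0) = {z}" using sing[OF 1(2)] sing[OF 1(3)] by auto
    then show False using 1(1) by auto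
  qed
  then have "krull_dim T \<le> 0"
    unfolding krull_dim_def by (intro Sup_least) (auto simp: zero_enat_def)
  then show ?thesis by simp
qed

text \<open>Proper closed sets are finite, so two of them cannot cover the infinite space and the
  space is irreducible. A closed point below it is a chain of length 1.\<close>

lemma krull_dim_cofinite_pos:
  assumes t1: "t1_space T" and inf: "infinite (topspace T)"
    and cofin: "\<And>U. openin T U \<Longrightarrow> U \<noteq> {} \<Longrightarrow> finite (topspace T - U)"
  shows "krull_dim T > 0"
proof -
  have closed_fin: "finite F \<or> F = topspace T" if "closedin T F" for F
  proof -
    have "openin T (topspace T - F)" "F \<subseteq> topspace T" using that by (auto simp: closedin_def)
    then show ?thesis using cofin[of "topspace T - F"] by (metis Diff_eq_empty_iff Diff_Diff_Int inf_absorb2 subset_antisym)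
  qed
  have irr: "irreducible_in T (topspace T)"
    unfolding irreducible_in_def
  proof (intro conjI allI impI)
    show "topspace T \<noteq> {}" using inf by auto
    fix F G assume FG: "closedin T F \<and> closedin T G \<and> topspace T \<subseteq> F \<union> G"
    then have "\<not> (finite F \<and> finite G)" using inf by (meson finite_Un finite_subset)
    then show "topspace T \<subseteq> F \<or> topspace T \<subseteq> G" using closed_fin FG by blast
  qed simp
  obtain z where z: "z \<in> topspace T" using inf by (metis finite.emptyI all_not_in_conv)
  define Z where "Z i = (if i = 0 then {z} else topspace T)" for i :: nat
  have "closedin T {z}" using t1 z unfolding t1_space_closedin_singleton by blast
  moreover have "irreducible_in T {z}" using z unfolding irreducible_in_def by auto
  moreover have "{z} \<subset> topspace T" using z inf by (metis finite.emptyI finite.insertI insert_subset empty_subsetI psubsetI)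
  ultimately have "\<forall>i\<le>1. closedin T (Z i) \<and> irreducible_in T (Z i)" "\<forall>i<1. Z i \<subset> Z (Suc i)"
    using irr by (auto simp: Z_def)
  then have "enat 1 \<le> krull_dim T" unfolding krull_dim_def by (intro Sup_upper) blast
  then show ?thesis by (metis enat_0_iff(1) iless_eSuc0 not_less one_eSuc one_enat_def zero_neq_one leD less_le_trans not_gr_zero)
qed

section \<open>The Zariski topology\<close>

lemma topspace_zariski:
  assumes "finite I" shows "topspace (zariski I) = proj_space I"
proof -
  have "{p \<in> proj_space I. \<not> vanishes_at (\<lambda>v. 1) p} = proj_space I"
    by (auto simp: proj_space_def projectivization_def vanishes_at_def span_singleton)
  then show ?thesis unfolding zariski_def topology_generated_by_topspace using forms_const[OF assms, of 1] by blast
qed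

lemma openin_zariski_basic:
  "f \<in> forms I k \<Longrightarrow> openin (zariski I) {p \<in> proj_space I. \<not> vanishes_at f p}"
  unfolding zariski_def by (rule topology_generated_by_Basis) blast

text \<open>A linear form that vanishes on one of two distinct lines through the origin and not on
  the other separates the points.\<close>

lemma t1_space_zariski:
  assumes I: "finite I" shows "t1_space (zariski I)"
  unfolding t1_space_def topspace_zariski[OF I]
proof (intro ballI impI)
  fix p q assume p: "p \<in> proj_space I" and q: "q \<in> proj_space I" and "p \<noteq> q"
  obtain v where v: "v \<in> coord_space I" "v \<noteq> 0" "p = cv.span {v}"
    using p unfolding proj_space_def by (rule point_cases)
  obtain w where w: "w \<in> coord_space I" "w \<noteq> 0" "q = cv.span {w}"
    using q unfolding proj_space_def by (rule point_cases)
  have "v \<notin> cv.span {w}"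
  proof
    assume "v \<in> cv.span {w}"
    then obtain c where c: "v = cscale c w" unfolding span_singleton by blast
    then have "c \<noteq> 0" using v(2) by (auto simp: fun_eq_iff)
    then show False using \<open>p \<noteq> q\<close> c v(3) w(3) span_scale_nonzero by metis
  qed
  moreover have "cv.span {w} \<subseteq> coord_space I" using w by (intro cv.span_minimal subspace_coord_space) auto
  ultimately obtain c where c: "\<And>x. x \<in> cv.span {w} \<Longrightarrow> (\<Sum>m\<in>I. c m * x m) = 0" "(\<Sum>m\<in>I. c m * v m) \<noteq> 0"
    using separating_functional[OF I cv.subspace_span _ v(1)] by metis
  let ?f = "\<lambda>x. \<Sum>m\<in>I. c m * x m"
  have f: "?f \<in> forms I 1" by (rule forms_linear[OF I])
  have "vanishes_at ?f q" unfolding vanishes_at_def w(3) using c(1) by blast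
  moreover have "\<not> vanishes_at ?f p" unfolding v(3) vanishes_at_span[OF f] by (rule c(2))
  ultimately show "\<exists>U. openin (zariski I) U \<and> p \<in> U \<and> q \<notin> U"
    using openin_zariski_basic[OF f] p by blast
qed

text \<open>This transfers the Krull dimension from projective space to its Veronese image, so that
  the smoothness criteria on both sides compare the same numbers.\<close>

lemma homeomorphic_map_veronese:
  assumes I: "finite I" and d: "d \<ge> 1"
  shows "homeomorphic_map (zariski I) (subtopology (zariski (exponents I d)) (veronese I d ` proj_space I))
    (veronese I d)"
  unfolding homeomorphic_map_maps
proof (rule exI[of _ "inv_into (proj_space I) (veronese I d)"])
  note J = finite_exponents[OF I, of d]
  let ?S = "veronese I d ` proj_space I"
  let ?T = "subtopology (zariski (exponents I d)) ?S"
  let ?g = "inv_into (proj_space I) (veronese I d)"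
  have S: "?S \<subseteq> proj_space (exponents I d)" using veronese_in_proj_space[OF I] by blast
  have topT: "topspace ?T = ?S" using S by (auto simp: topspace_zariski[OF J])
  have inj: "inj_on (veronese I d) (proj_space I)" by (rule inj_on_veronese[OF I d])
  have van: "vanishes_at f (veronese I d p) \<longleftrightarrow> vanishes_at (\<lambda>v. f (veronese_vec I d v)) p"
    if f: "f \<in> forms (exponents I d) k" and p: "p \<in> proj_space I" for f k p
  proof -
    obtain v where v: "p = cv.span {v}" using p unfolding proj_space_def by (rule point_cases)
    show ?thesis unfolding v veronese_span vanishes_at_span[OF f]
        vanishes_at_span[OF forms_pullback_veronese[OF I f]] ..
  qed
  have "continuous_map (zariski I) (zariski (exponents I d)) (veronese I d)"
    unfolding zariski_def[of "exponents I d"]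
  proof (rule continuous_on_generated_topo)
    fix U assume "U \<in> {{p \<in> proj_space (exponents I d). \<not> vanishes_at f p} | f k. f \<in> forms (exponents I d) k}"
    then obtain f k where f: "f \<in> forms (exponents I d) k"
      "U = {p \<in> proj_space (exponents I d). \<not> vanishes_at f p}" by blast
    have "veronese I d -` U \<inter> proj_space I = {p \<in> proj_space I. \<not> vanishes_at (\<lambda>v. f (veronese_vec I d v)) p}"
      using f van S by auto
    then show "openin (zariski I) (veronese I d -` U \<inter> topspace (zariski I))"
      using openin_zariski_basic[OF forms_pullback_veronese[OF I f(1)]] by (simp add: topspace_zariski[OF I])
  next
    show "veronese I d ` topspace (zariski I) \<subseteq>
        \<Union> {{p \<in> proj_space (exponents I d). \<not> vanishes_at f p} | f k. f \<in> forms (exponents I d) k}"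
      using S topspace_zariski[OF J] unfolding topspace_zariski[OF I]
      by (simp add: zariski_def)
  qed
  then have 1: "continuous_map (zariski I) ?T (veronese I d)"
    by (simp add: continuous_map_in_subtopology topspace_zariski[OF I] image_subset_iff)
  have 2: "continuous_map ?T (zariski I) ?g"
    unfolding zariski_def[of I]
  proof (rule continuous_on_generated_topo)
    fix U assume "U \<in> {{p \<in> proj_space I. \<not> vanishes_at f p} | f k. f \<in> forms I k}"
    then obtain f k where f: "f \<in> forms I k" "U = {p \<in> proj_space I. \<not> vanishes_at f p}" by blast
    \<comment> \<open>The degree of \<open>f\<close> need not be divisible by \<open>d\<close>; its
      \<open>d\<close>-th power has the same zeros and does descend to the Veronese image.\<close>
    have fd: "(\<lambda>v. f v ^ d) \<in> forms I (k * d)" using forms_power[OF I f(1), of d] by (simp add: mult.commute)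
    obtain h where h: "h \<in> forms (exponents I d) k" "\<And>v. h (veronese_vec I d v) = f v ^ d"
      using forms_pushforward_veronese[OF I fd] by blast
    have eq: "vanishes_at h (veronese I d p) \<longleftrightarrow> vanishes_at f p" if "p \<in> proj_space I" for p
      unfolding van[OF h(1) that] h(2) using d by (auto simp: vanishes_at_def)
    have "?g -` U \<inter> ?S = ?S \<inter> {p \<in> proj_space (exponents I d). \<not> vanishes_at h p}"
    proof (rule set_eqI)
      fix y
      show "y \<in> ?g -` U \<inter> ?S \<longleftrightarrow> y \<in> ?S \<inter> {p \<in> proj_space (exponents I d). \<not> vanishes_at h p}"
      proof (cases "y \<in> ?S")
        case True
        then obtain p where p: "p \<in> proj_space I" "y = veronese I d p" by blast
        then show ?thesis using eq[OF p(1)] S f(2) inv_into_f_f[OF inj p(1)] by auto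
      qed auto
    qed
    then show "openin ?T (?g -` U \<inter> topspace ?T)"
      unfolding topT using openin_zariski_basic[OF h(1)] by (simp add: openin_subtopology_Int2)
  next
    show "?g ` topspace ?T \<subseteq> \<Union> {{p \<in> proj_space I. \<not> vanishes_at f p} | f k. f \<in> forms I k}"
      using topspace_zariski[OF I] inv_into_f_f[OF inj] unfolding topT by (auto simp: zariski_def)
  qed
  show "homeomorphic_maps (zariski I) ?T (veronese I d) ?g"
    unfolding homeomorphic_maps_def topspace_zariski[OF I] topT
    using 1 2 inv_into_f_f[OF inj] f_inv_into_f[of _ "veronese I d" "proj_space I"] by blast
qed

lemma proj_dim_veronese:
  assumes "finite I" "d \<ge> 1"
  shows "proj_dim (exponents I d) (veronese I d ` proj_space I) = proj_dim I (proj_space I)"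
proof -
  have "subtopology (zariski I) (proj_space I) = zariski I"
    using subtopology_topspace[of "zariski I"] by (simp add: topspace_zariski[OF assms(1)])
  then show ?thesis unfolding proj_dim_def
    using krull_dim_homeomorphic[OF homeomorphic_map_veronese[OF assms]] by simp
qed

section \<open>Smooth loci of projective spaces and Veronese varieties\<close>

text \<open>All tangent cones equal the coordinate space, so the locus is everything or nothing.
  Which of the two holds is left open here, as this would require the Krull dimension of projective
  space.\<close>

lemma smooth_locus_proj_space:
  assumes "finite I"
  shows "smooth_locus I (proj_space I) =
    (if enat (cv.dim (coord_space I)) = proj_dim I (proj_space I) + 1 then proj_space I else {})"
  using tangent_cone_proj_space[OF assms] by (auto simp: smooth_locus_def)

lemma smooth_locus_veronese:
  assumes "finite I" "d \<ge> 1"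
  shows "smooth_locus (exponents I d) (veronese I d ` proj_space I) =
    veronese I d ` smooth_locus I (proj_space I)"
  unfolding smooth_locus_proj_space[OF assms(1)]
  by (auto simp: smooth_locus_def dim_tangent_cone_veronese[OF assms] proj_dim_veronese[OF assms])

section \<open>Forms on lines\<close>

text \<open>An affine chart of the line: its points other than the one spanned by \<open>w\<close>,
  parametrized by \<open>t\<close>.\<close>

lemma inj_affine_line_points:
  assumes "v \<noteq> w" "cv.independent {v, w}" shows "inj (\<lambda>t. cv.span {v + cscale t w})"
proof (rule injI)
  have ind: "v \<noteq> 0" "w \<noteq> 0" "w \<notin> cv.span {v}" "v \<notin> cv.span {w}"
    using assms independent_pair_iff[of v w] independent_pair_iff[of w v] by (auto simp: insert_commute)
  fix s t assume "cv.span {v + cscale s w} = cv.span {v + cscale t w}"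
  moreover have "v + cscale s w \<in> cv.span {v + cscale s w}" by (simp only: cv.span_base insertI1)
  ultimately obtain c where c: "v + cscale s w = cscale c (v + cscale t w)"
    unfolding span_singleton by blast
  then have pt: "v i + s * w i = c * (v i + t * w i)" for i
    by (drule_tac x = i in fun_cong) simp
  have c1: "c = 1"
  proof (rule ccontr)
    assume "c \<noteq> 1"
    then have "v = cscale ((c * t - s) / (1 - c)) w"
      using pt by (auto simp: fun_eq_iff field_simps)
    then show False using ind(4) unfolding span_singleton by blast
  qed
  obtain i where "w i \<noteq> 0" using ind(2) by (auto simp: fun_eq_iff)
  then show "s = t" using pt[of i] c1 by simp
qed

text \<open>A form with more zeros on a line than its degree vanishes on the line: restrict to the affine
  chart of the line around \<open>q\<close> obtained by removing a point off \<open>S\<close>.\<close>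

lemma form_vanishes_on_line:
  assumes I: "finite I" and g: "g \<in> forms I k"
    and vw: "v \<noteq> w" "cv.independent {v, w}"
    and S: "finite S" "card S > k" "S \<subseteq> projectivization (cv.span {v, w})" "\<And>p. p \<in> S \<Longrightarrow> vanishes_at g p"
    and q: "q \<in> cv.span {v, w}"
  shows "g q = 0"
proof (cases "q = 0 \<or> cv.span {q} \<in> S")
  case True
  then show ?thesis
  proof
    assume "q = 0"
    moreover obtain p where p: "p \<in> S" using S(2) by fastforce
    moreover have "0 \<in> p" using S(3) p cv.span_zero unfolding projectivization_def by blast
    ultimately show ?thesis using S(4) unfolding vanishes_at_def by blast
  next
    assume "cv.span {q} \<in> S"
    then show ?thesis using S(4) vanishes_at_span[OF g] by blast
  qed
next
  case False
  let ?W = "cv.span {v, w}"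
  have "\<not> ?W \<subseteq> cv.span {q}"
  proof
    assume "?W \<subseteq> cv.span {q}"
    then have "cv.dim ?W \<le> card {q}" by (intro cv.dim_le_card) auto
    then show False using dim_span_pair[OF vw] by simp
  qed
  then obtain b0 where b0: "b0 \<in> ?W" "b0 \<notin> cv.span {q}" by blast
  then have "q \<noteq> b0 \<and> cv.independent {q, b0}" using independent_pair_iff False by blast
  then have "inj (\<lambda>t. cv.span {b0 + cscale t q})"
    by (intro inj_affine_line_points) (auto simp: insert_commute)
  then have "infinite (range (\<lambda>t. cv.span {b0 + cscale t q}))"
    using infinite_UNIV_char_0 by (metis finite_imageD)
  then obtain t where t: "cv.span {b0 + cscale t q} \<notin> S" using S(1) by (meson finite_subset image_subsetI)
  \<comment> \<open>\<open>b\<close> spans the point sent to infinity. The chart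
    \<open>q + cscale s b\<close> then has \<open>q\<close> at \<open>s = 0\<close> and contains all
    of \<open>S\<close>.\<close>
  define b where "b = b0 + cscale t q"
  have bW: "b \<in> ?W" unfolding b_def using b0(1) q by (intro cv.span_add cv.span_scale)
  have bq: "b \<notin> cv.span {q}"
  proof
    assume "b \<in> cv.span {q}"
    moreover have "cscale t q \<in> cv.span {q}" by (intro cv.span_scale cv.span_base) simp
    ultimately have "b - cscale t q \<in> cv.span {q}" by (rule cv.span_diff)
    moreover have "b - cscale t q = b0" by (simp add: b_def fun_eq_iff)
    ultimately show False using b0(2) by simp
  qed
  have qb: "q \<noteq> b" "cv.independent {q, b}" using independent_pair_iff[of q b] bq False by blast+
  have "cv.span {q, b} = ?W"
  proof (rule subset_antisym)
    show "cv.span {q, b} \<subseteq> ?W" using q bW by (intro cv.span_minimal) auto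
    show "?W \<subseteq> cv.span {q, b}"
    proof (rule ccontr)
      assume "\<not> ?W \<subseteq> cv.span {q, b}"
      then obtain c where c: "c \<in> ?W" "c \<notin> cv.span {q, b}" by blast
      have "c \<notin> {q, b}" using c(2) cv.span_base by blast
      then have "cv.independent {c, q, b}"
        using qb(2) c(2) cv.independent_insert[of c "{q, b}"] by presburger
      moreover have "card {c, q, b} = 3" using \<open>c \<notin> {q, b}\<close> qb(1) by simp
      moreover have "{c, q, b} \<subseteq> cv.span {v, w}" using c q bW by blast
      ultimately have "3 \<le> card {v, w}"
        using cv.independent_span_bound[of "{v, w}" "{c, q, b}"] by simp
      then show False using card_insert_le_m1[of 2 "{w}" v] by simp
    qed
  qed
  obtain P where P: "degree P \<le> k" "\<And>s. g (q + cscale s b) = poly P s"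
    using forms_restrict_line[OF I g, of q b] by blast
  have "\<exists>s. p = cv.span {q + cscale s b}" if p: "p \<in> S" for p
  proof -
    obtain z where z: "z \<in> ?W" "z \<noteq> 0" "p = cv.span {z}" using S(3) p by (blast elim: point_cases)
    then obtain x y where xy: "z = cscale x q + cscale y b"
      using \<open>cv.span {q, b} = ?W\<close> unfolding span_pair by blast
    \<comment> \<open>With \<open>x = 0\<close> the point \<open>p\<close> of \<open>S\<close> would
      be the removed point.\<close>
    have "x \<noteq> 0"
    proof
      assume "x = 0"
      then have "z = cscale y b" using xy by (simp add: fun_eq_iff)
      moreover have "y \<noteq> 0" using z(2) calculation by (auto simp: fun_eq_iff)
      ultimately have "p = cv.span {b}" using z(3) span_scale_nonzero by blast
      then show False using t p unfolding b_def by blast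
    qed
    then have "z = cscale x (q + cscale (y / x) b)" using xy by (simp add: fun_eq_iff distrib_left)
    then show ?thesis using z(3) span_scale_nonzero[OF \<open>x \<noteq> 0\<close>] by blast
  qed
  \<comment> \<open>\<open>\<sigma>\<close> gives the chart parameter of each point of
    \<open>S\<close>. These are more than \<open>k\<close> distinct roots of \<open>P\<close>, whose
    degree is at most \<open>k\<close>.\<close>
  then obtain \<sigma> where \<sigma>: "\<And>p. p \<in> S \<Longrightarrow> p = cv.span {q + cscale (\<sigma> p) b}" by metis
  have "inj_on \<sigma> S" using \<sigma> by (metis inj_onI)
  then have "card (\<sigma> ` S) = card S" by (rule card_image)
  moreover have root: "poly P x = 0" if x: "x \<in> \<sigma> ` S" for x
  proof -
    obtain p where p: "p \<in> S" "x = \<sigma> p" using x by blast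
    have "vanishes_at g (cv.span {q + cscale x b})" using S(4)[OF p(1)] \<sigma>[OF p(1)] p(2) by metis
    then show ?thesis unfolding vanishes_at_span[OF g] P(2) .
  qed
  ultimately have "P = 0"
    using S(2) P(1) card_poly_roots_bound[of P] card_mono[OF poly_roots_finite[of P], of "\<sigma> ` S"]
    by fastforce
  moreover have "q + cscale 0 b = q" by (simp add: fun_eq_iff)
  ultimately show ?thesis using P(2)[of 0] by simp
qed

lemma infinite_proj_line:
  assumes "v \<noteq> w" "cv.independent {v, w}" shows "infinite (projectivization (cv.span {v, w}))"
proof
  assume fin: "finite (projectivization (cv.span {v, w}))"
  have "range (\<lambda>t. cv.span {v + cscale t w}) \<subseteq> projectivization (cv.span {v, w})"
  proof (intro image_subsetI)
    fix t
    have "v + cscale t w \<in> cv.span {v, w}" by (intro cv.span_add cv.span_scale cv.span_base) auto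
    moreover have "v + cscale t w \<noteq> 0"
    proof
      assume 0: "v + cscale t w = 0"
      have "v = cscale (- t) w"
      proof
        fix i show "v i = cscale (- t) w i" using fun_cong[OF 0, of i] by (simp add: add_eq_0_iff2)
      qed
      then have "v \<in> cv.span {w}" unfolding span_singleton by blast
      then show False using independent_pair_iff[of w v] assms by (simp add: insert_commute)
    qed
    ultimately show "cv.span {v + cscale t w} \<in> projectivization (cv.span {v, w})"
      unfolding projectivization_def by blast
  qed
  then have "finite (range (\<lambda>t. cv.span {v + cscale t w}))" using fin by (rule finite_subset)
  then show False using inj_affine_line_points[OF assms] infinite_UNIV_char_0 by (metis finite_imageD)
qed

text \<open>On the image of a line a form has finitely many zeros or vanishes throughout, so the
  induced Zariski topology has cofinite nonempty open sets and \<open>krull_dim_cofinite_pos\<close>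
  applies.\<close>

lemma veronese_line_dim_pos:
  assumes I: "finite I" and d: "d \<ge> 1" and vw: "v \<noteq> w" "cv.independent {v, w}" "cv.span {v, w} \<subseteq> coord_space I"
  shows "proj_dim (exponents I d) (veronese I d ` projectivization (cv.span {v, w})) > 0"
proof -
  note J = finite_exponents[OF I, of d]
  let ?L = "projectivization (cv.span {v, w})"
  let ?R = "veronese I d ` ?L"
  let ?T = "subtopology (zariski (exponents I d)) ?R"
  have L: "?L \<subseteq> proj_space I"
    unfolding proj_space_def projectivization_subset_iff[OF cv.subspace_span subspace_coord_space] by (rule vw(3))
  have R: "?R \<subseteq> proj_space (exponents I d)" using L veronese_in_proj_space[OF I] by blast
  have topT: "topspace ?T = ?R" using R by (auto simp: topspace_zariski[OF J])
  \<comment> \<open>The alternative of an empty trace makes the statement stable under finite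
    intersections and arbitrary unions, as induction over generated open sets requires.\<close>
  have cofin: "U \<inter> ?R = {} \<or> finite (?R - U)"
    if "generate_topology_on {{p \<in> proj_space (exponents I d). \<not> vanishes_at f p} | f k. f \<in> forms (exponents I d) k} U"
    for U
    using that
  proof induction
    case (Int A B)
    have "finite (?R - A \<inter> B)" if "finite (?R - A)" "finite (?R - B)"
      unfolding Diff_Int using that by (rule finite_UnI)
    then show ?case using Int.IH by blast
  next
    case (UN K)
    show ?case
    proof (cases "\<exists>A\<in>K. A \<inter> ?R \<noteq> {}")
      case True
      then obtain A where "A \<in> K" "finite (?R - A)" using UN by blast
      moreover have "?R - \<Union>K \<subseteq> ?R - A" using calculation by blast
      ultimately show ?thesis by (meson finite_subset)
    qed blast
  next
    case (Basis U)
    then obtain f k where f: "f \<in> forms (exponents I d) k"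
      "U = {p \<in> proj_space (exponents I d). \<not> vanishes_at f p}" by blast
    let ?g = "\<lambda>v. f (veronese_vec I d v)"
    have g: "?g \<in> forms I (k * d)" by (rule forms_pullback_veronese[OF I f(1)])
    have van: "vanishes_at f (veronese I d p) \<longleftrightarrow> vanishes_at ?g p" if p: "p \<in> ?L" for p
    proof -
      obtain v where v: "p = cv.span {v}" using p by (rule point_cases)
      show ?thesis unfolding v veronese_span vanishes_at_span[OF f(1)] vanishes_at_span[OF g] ..
    qed
    let ?Z = "{p \<in> ?L. vanishes_at ?g p}"
    show ?case
    proof (cases "finite ?Z")
      case True
      have "?R - U \<subseteq> veronese I d ` ?Z" using van R unfolding f(2) by blast
      then show ?thesis using True by (meson finite_imageI finite_subset)
    next
      case False
      \<comment> \<open>The pullback has degree \<open>k * d\<close>, so one more zero than that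
        makes it vanish on the whole line; then \<open>U\<close> misses the curve.\<close>
      then obtain S where S: "S \<subseteq> ?Z" "finite S" "card S = Suc (k * d)" by (meson infinite_arbitrarily_large)
      have zero: "?g q = 0" if "q \<in> cv.span {v, w}" for q
        by (rule form_vanishes_on_line[OF I g vw(1,2) S(2) _ _ _ that]) (use S in auto)
      have "vanishes_at ?g p" if "p \<in> ?L" for p
        using that
      proof (rule point_cases)
        fix z assume "z \<in> cv.span {v, w}" "p = cv.span {z}"
        then show "vanishes_at ?g p" using vanishes_at_span[OF g] zero by blast
      qed
      then show ?thesis using van unfolding f(2) by blast
    qed
  qed simp
  have "krull_dim ?T > 0"
  proof (rule krull_dim_cofinite_pos)
    show "t1_space ?T" by (intro t1_space_subtopology t1_space_zariski J)
    have "inj_on (veronese I d) ?L" using inj_on_veronese[OF I d] L by (rule inj_on_subset)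
    then show "infinite (topspace ?T)"
      unfolding topT using infinite_proj_line[OF vw(1,2)] by (metis finite_imageD)
    fix U assume "openin ?T U" "U \<noteq> {}"
    then obtain V where V: "openin (zariski (exponents I d)) V" "U = V \<inter> ?R"
      unfolding openin_subtopology by blast
    then have "finite (?R - V)"
      using cofin[of V] \<open>U \<noteq> {}\<close> unfolding zariski_def openin_topology_generated_by_iff by blast
    moreover have "?R - U = ?R - V" using V(2) by blast
    ultimately show "finite (topspace ?T - U)" unfolding topT by simp
  qed
  then show ?thesis unfolding proj_dim_def .
qed

section \<open>Products of linear forms\<close>

definition linear_form :: "'i set \<Rightarrow> ('i \<Rightarrow> complex) \<Rightarrow> ('i \<Rightarrow> complex) \<Rightarrow> complex" where
  "linear_form I c x = (\<Sum>i\<in>I. c i * x i)"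

lemma linear_form_in_forms: "finite I \<Longrightarrow> linear_form I c \<in> forms I 1"
  using forms_linear[of I c] unfolding linear_form_def .

lemma dir_deriv_linear_form:
  assumes "finite I" shows "dir_deriv I (linear_form I c) v u = linear_form I c u"
proof (rule dir_deriv_eqI[OF assms linear_form_in_forms[OF assms]])
  have "linear_form I c (v + cscale t u) = linear_form I c v + t * linear_form I c u" for t
    by (simp add: linear_form_def distrib_left sum.distrib sum_distrib_left mult_ac)
  then show "((\<lambda>t. linear_form I c (v + cscale t u)) has_field_derivative linear_form I c u) (at 0)"
    by (auto intro!: derivative_eq_intros)
qed

lemma dir_deriv_mult:
  assumes I: "finite I" and f: "f \<in> forms I a" and g: "g \<in> forms I b"
  shows "dir_deriv I (\<lambda>v. f v * g v) v u = dir_deriv I f v u * g v + dir_deriv I g v u * f v"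
proof (rule dir_deriv_eqI[OF I forms_mult[OF I f g]])
  have v: "v + cscale 0 u = v" by (simp add: fun_eq_iff)
  show "((\<lambda>t. f (v + cscale t u) * g (v + cscale t u)) has_field_derivative
      dir_deriv I f v u * g v + dir_deriv I g v u * f v) (at 0)"
    using DERIV_mult[OF has_dir_deriv[OF I f, of v u] has_dir_deriv[OF I g, of v u]] unfolding v .
qed

lemma separating_linear_form:
  assumes "finite I" "S \<subseteq> coord_space I" "q \<in> coord_space I" "q \<notin> cv.span S"
  obtains c where "\<And>v. v \<in> S \<Longrightarrow> linear_form I c v = 0" "linear_form I c q \<noteq> 0"
proof -
  have "cv.span S \<subseteq> coord_space I" using assms(2) by (rule cv.span_minimal[OF _ subspace_coord_space])
  from separating_functional[OF assms(1) cv.subspace_span this assms(3,4)]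
  obtain c where "\<And>v. v \<in> cv.span S \<Longrightarrow> (\<Sum>m\<in>I. c m * v m) = 0" "(\<Sum>m\<in>I. c m * q m) \<noteq> 0" by blast
  then show thesis using that[of c] cv.span_base unfolding linear_form_def by blast
qed

text \<open>Split off the \<open>i\<close>-th factor and apply the product rule. If another factor
  also vanishes at \<open>a\<close>, both summands are zero. If the \<open>i\<close>-th factor is
  the only one vanishing there, the first summand survives in any direction \<open>u\<close> off its
  hyperplane.\<close>

lemma
  fixes c :: "nat \<Rightarrow> 'i \<Rightarrow> complex" and d :: nat
  assumes I: "finite I"
  defines "F \<equiv> \<lambda>v. \<Prod>k<d. linear_form I (c k) v"
  shows prod_linear_forms_in_forms: "F \<in> forms I d"
    and prod_linear_forms_singular: "i < d \<Longrightarrow> j < d \<Longrightarrow> i \<noteq> j \<Longrightarrow> linear_form I (c i) a = 0 \<Longrightarrow>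
      linear_form I (c j) a = 0 \<Longrightarrow> singular_form I F a"
    and prod_linear_forms_nonsingular: "i < d \<Longrightarrow> u \<in> coord_space I \<Longrightarrow> linear_form I (c i) u \<noteq> 0 \<Longrightarrow>
      linear_form I (c i) a = 0 \<Longrightarrow> (\<And>k. k < d \<Longrightarrow> k \<noteq> i \<Longrightarrow> linear_form I (c k) a \<noteq> 0) \<Longrightarrow>
      \<not> singular_form I F a"
proof -
  have "(\<lambda>v. \<Prod>k<d. linear_form I (c k) v) \<in> forms I (\<Sum>k<d. 1)"
    by (intro forms_prod I linear_form_in_forms) auto
  then show F: "F \<in> forms I d" by (simp add: F_def)
  have deriv: "dir_deriv I F a u = linear_form I (c i) u * (\<Prod>k\<in>{..<d} - {i}. linear_form I (c k) a)
      + dir_deriv I (\<lambda>v. \<Prod>k\<in>{..<d} - {i}. linear_form I (c k) v) a u * linear_form I (c i) a"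
    if i: "i < d" for i a u
  proof -
    have "F = (\<lambda>v. linear_form I (c i) v * (\<Prod>k\<in>{..<d} - {i}. linear_form I (c k) v))"
      unfolding F_def using i by (intro ext prod.remove) auto
    moreover have "(\<lambda>v. \<Prod>k\<in>{..<d} - {i}. linear_form I (c k) v) \<in> forms I (\<Sum>k\<in>{..<d} - {i}. 1)"
      by (intro forms_prod I linear_form_in_forms) auto
    ultimately show ?thesis
      using dir_deriv_mult[OF I linear_form_in_forms[OF I]] by (simp only: dir_deriv_linear_form[OF I])
  qed
  show "singular_form I F a"
    if ij: "i < d" "j < d" "i \<noteq> j" "linear_form I (c i) a = 0" "linear_form I (c j) a = 0" for i j a
  proof -
    have "(\<Prod>k\<in>{..<d} - {i}. linear_form I (c k) a) = 0"
      using ij by (intro prod_zero) auto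
    then show ?thesis unfolding singular_form_def deriv[OF ij(1)] ij(4) by simp
  qed
  show "\<not> singular_form I F a"
    if i: "i < d" "u \<in> coord_space I" "linear_form I (c i) u \<noteq> 0" "linear_form I (c i) a = 0"
      "\<And>k. k < d \<Longrightarrow> k \<noteq> i \<Longrightarrow> linear_form I (c k) a \<noteq> 0" for i u a
  proof -
    have "(\<Prod>k\<in>{..<d} - {i}. linear_form I (c k) a) \<noteq> 0" using i(5) by auto
    then have "dir_deriv I F a u \<noteq> 0" unfolding deriv[OF i(1)] i(4) using i(3) by simp
    then show ?thesis unfolding singular_form_def using i(2) by blast
  qed
qed

lemma nonsingular_if_nonzero:
  assumes "finite I" "F \<in> forms I d" "d \<ge> 1" "q \<in> coord_space I" "F q \<noteq> 0"
  shows "\<not> singular_form I F q"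
  using dir_deriv_euler[OF assms(1,2), of q] assms(3-5) unfolding singular_form_def by force

section \<open>Forms singular along a non-collinear set\<close>

text \<open>Exchange: a line through \<open>q\<close> is spanned by \<open>q\<close> and any other
  of its points. Hence equality of spans detects lying on the same line through
  \<open>q\<close>.\<close>

lemma span_pair_eq_iff:
  assumes "a \<noteq> 0" "b \<notin> cv.span {q}" "b \<in> cv.span {q, a}" shows "cv.span {q, b} = cv.span {q, a}"
proof -
  obtain x y where xy: "b = cscale x q + cscale y a" using assms(3) unfolding span_pair by blast
  have "y \<noteq> 0"
  proof
    assume "y = 0"
    then have "b = cscale x q" using xy by (simp add: fun_eq_iff)
    then show False using assms(2) unfolding span_singleton by blast
  qed
  then have "a = cscale (- x / y) q + cscale (1 / y) b" using xy by (simp add: fun_eq_iff field_simps)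
  then have "a \<in> cv.span {q, b}" unfolding span_pair by blast
  then have "{q, b} \<subseteq> cv.span {q, a}" "{q, a} \<subseteq> cv.span {q, b}"
    using assms(3) by (auto intro: cv.span_base)
  then show ?thesis by (simp only: cv.span_eq)
qed

text \<open>If \<open>q\<close> were on the line joining \<open>a\<close> and \<open>b\<close>, both
  joins with \<open>q\<close> would be that line. So points on different lines through
  \<open>q\<close> can be joined by a line missing \<open>q\<close>.\<close>

lemma span_pair_avoids:
  assumes q: "q \<notin> cv.span {a}" "q \<notin> cv.span {b}" and neq: "cv.span {q, a} \<noteq> cv.span {q, b}"
  shows "q \<notin> cv.span {a, b}"
proof
  assume "q \<in> cv.span {a, b}"
  then obtain x y where xy: "q = cscale x a + cscale y b" unfolding span_pair by blast
  have "x \<noteq> 0"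
  proof
    assume "x = 0"
    then have "q = cscale y b" using xy by (simp add: fun_eq_iff)
    then show False using q(2) unfolding span_singleton by blast
  qed
  have "y \<noteq> 0"
  proof
    assume "y = 0"
    then have "q = cscale x a" using xy by (simp add: fun_eq_iff)
    then show False using q(1) unfolding span_singleton by blast
  qed
  have "a = cscale (1 / x) q + cscale (- y / x) b" "b = cscale (1 / y) q + cscale (- x / y) a"
    using xy \<open>x \<noteq> 0\<close> \<open>y \<noteq> 0\<close> by (simp_all add: fun_eq_iff field_simps)
  then have "a \<in> cv.span {q, b}" "b \<in> cv.span {q, a}" unfolding span_pair by blast+
  then have "{q, b} \<subseteq> cv.span {q, a}" "{q, a} \<subseteq> cv.span {q, b}" by (auto intro: cv.span_base)
  then show False using neq by (simp only: cv.span_eq simp_thms)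
qed

text \<open>Listing \<open>A\<close> class by class, two positions at least half of the length apart lie in different
  classes, so that a cyclic shift by half of the length pairs elements of different classes.\<close>

lemma cyclic_pairing:
  fixes \<kappa> :: "'a \<Rightarrow> 'b"
  assumes A: "finite A" "card A = d" "d \<ge> 2" and small: "\<And>a. a \<in> A \<Longrightarrow> card {b \<in> A. \<kappa> b = \<kappa> a} \<le> d div 2"
  obtains y \<sigma> where "y ` {..<d} = A" "\<sigma> ` {..<d} = {..<d}"
    "\<And>i. i < d \<Longrightarrow> \<sigma> i \<noteq> i" "\<And>i. i < d \<Longrightarrow> \<kappa> (y i) \<noteq> \<kappa> (y (\<sigma> i))"
proof -
  define h where "h = d div 2"
  \<comment> \<open>\<open>h \<le> d - h\<close> serves the positions that wrap around: they move
    back by \<open>d - h\<close>, still at least \<open>h\<close>, even for odd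
    \<open>d\<close>.\<close>
  have h: "1 \<le> h" "h < d" "h \<le> d - h" using A(3) by (auto simp: h_def)
  \<comment> \<open>Classes are numbered only to have a linear order by which the list can be
    sorted.\<close>
  obtain num :: "'b \<Rightarrow> nat" where num: "inj_on num (\<kappa> ` A)"
    using finite_imp_inj_to_nat_seg[of "\<kappa> ` A"] A(1) by blast
  obtain zs where zs: "set zs = A" "distinct zs" using finite_distinct_list[OF A(1)] by blast
  define xs where "xs = sort_key (\<lambda>a. num (\<kappa> a)) zs"
  have xs: "set xs = A" "distinct xs" "sorted (map (\<lambda>a. num (\<kappa> a)) xs)" using zs by (simp_all add: xs_def)
  have len: "length xs = d" using distinct_card[OF xs(2)] xs(1) A(2) by simp
  have far: "\<kappa> (xs ! i) \<noteq> \<kappa> (xs ! j)" if ij: "i + h \<le> j" "j < d" for i j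
  proof
    assume eq: "\<kappa> (xs ! i) = \<kappa> (xs ! j)"
    \<comment> \<open>In the sorted list everything between two members of a class belongs to it, so
      this class would have at least \<open>h + 1\<close> elements.\<close>
    have "(\<lambda>k. xs ! k) ` {i..j} \<subseteq> {b \<in> A. \<kappa> b = \<kappa> (xs ! i)}"
    proof (intro image_subsetI CollectI conjI)
      fix k assume k: "k \<in> {i..j}"
      show kA: "xs ! k \<in> A" using k ij(2) len xs(1) nth_mem by (metis atLeastAtMost_iff le_less_trans)
      have "num (\<kappa> (xs ! i)) \<le> num (\<kappa> (xs ! k))" "num (\<kappa> (xs ! k)) \<le> num (\<kappa> (xs ! j))"
        using sorted_nth_mono[OF xs(3), of i k] sorted_nth_mono[OF xs(3), of k j] k ij len by auto
      then have "num (\<kappa> (xs ! k)) = num (\<kappa> (xs ! i))" using eq by simp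
      moreover have "xs ! i \<in> A" using k ij(2) len xs(1) nth_mem by (metis atLeastAtMost_iff le_less_trans)
      ultimately show "\<kappa> (xs ! k) = \<kappa> (xs ! i)" using num kA by (auto dest: inj_onD)
    qed
    then have "card ((\<lambda>k. xs ! k) ` {i..j}) \<le> card {b \<in> A. \<kappa> b = \<kappa> (xs ! i)}"
      using A(1) by (intro card_mono) auto
    moreover have "inj_on (\<lambda>k. xs ! k) {i..j}"
      using xs(2) len ij(2) by (auto simp: inj_on_def nth_eq_iff_index_eq)
    ultimately have "card {i..j} \<le> card {b \<in> A. \<kappa> b = \<kappa> (xs ! i)}" by (simp add: card_image)
    moreover have "xs ! i \<in> A" using ij len xs(1) nth_mem[of i xs] by auto
    ultimately show False using small[of "xs ! i"] ij(1) by (simp add: h_def)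
  qed
  define \<sigma> where "\<sigma> i = (if i + h < d then i + h else i + h - d)" for i
  show thesis
  proof (rule that[of "\<lambda>i. xs ! i" \<sigma>])
    show "(\<lambda>i. xs ! i) ` {..<d} = A" using xs(1) len by (auto simp: set_conv_nth)
    show "\<sigma> ` {..<d} = {..<d}"
    proof (intro subset_antisym subsetI)
      fix k assume "k \<in> {..<d}"
      then have "k = \<sigma> (if h \<le> k then k - h else k + d - h)" "(if h \<le> k then k - h else k + d - h) < d"
        using h by (auto simp: \<sigma>_def)
      then show "k \<in> \<sigma> ` {..<d}" by blast
    qed (use h in \<open>auto simp: \<sigma>_def\<close>)
    show "\<sigma> i \<noteq> i" if "i < d" for i using h by (auto simp: \<sigma>_def)
    show "\<kappa> (xs ! i) \<noteq> \<kappa> (xs ! \<sigma> i)" if i: "i < d" for i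
    proof (cases "i + h < d")
      case True
      then show ?thesis using far[of i "i + h"] by (simp add: \<sigma>_def)
    next
      case False
      then have "\<kappa> (xs ! (i + h - d)) \<noteq> \<kappa> (xs ! i)" using far[of "i + h - d" i] h i by auto
      then show ?thesis using False by (simp add: \<sigma>_def)
    qed
  qed
qed

text \<open>If no line through \<open>q\<close> carries more than half of \<open>A\<close>, the
  cyclic pairing gives \<open>d\<close> joins that miss \<open>q\<close>, and the product is nonzero
  at \<open>q\<close>. Otherwise let \<open>C\<close> be the part of \<open>A\<close> on the crowded
  line and \<open>B\<close> the rest. One form takes care of the line; the other
  \<open>d - 1\<close> must meet \<open>C\<close> once and \<open>B\<close> twice, which is possible
  since \<open>card C \<le> d - 1\<close> and \<open>2 * card B \<le> d - 1\<close>.\<close>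

lemma noncollinear_separating_form:
  fixes A :: "('i \<Rightarrow> complex) set"
  assumes I: "finite I" and A: "finite A" "card A = d" "d \<ge> 2" "A \<subseteq> coord_space I"
    and q: "q \<in> coord_space I" "q \<noteq> 0"
    and indep: "\<And>a. a \<in> A \<Longrightarrow> a \<notin> cv.span {q}" "\<And>a. a \<in> A \<Longrightarrow> q \<notin> cv.span {a}"
    and ncol: "\<And>a. a \<in> A \<Longrightarrow> \<not> A \<subseteq> cv.span {q, a}"
  shows "\<exists>F\<in>forms I d. (\<forall>a\<in>A. singular_form I F a) \<and> \<not> singular_form I F q"
proof -
  let ?\<kappa> = "\<lambda>a. cv.span {q, a}"
  have line: "\<exists>c. linear_form I c a = 0 \<and> linear_form I c b = 0 \<and> linear_form I c q \<noteq> 0"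
    if ab: "a \<in> A" "b \<in> A" "?\<kappa> a \<noteq> ?\<kappa> b" for a b
  proof -
    have "q \<notin> cv.span {a, b}" using span_pair_avoids indep(2) ab by blast
    moreover have "{a, b} \<subseteq> coord_space I" using ab A(4) by blast
    ultimately obtain c where "\<And>v. v \<in> {a, b} \<Longrightarrow> linear_form I c v = 0" "linear_form I c q \<noteq> 0"
      using separating_linear_form[OF I _ q(1)] by metis
    then show ?thesis by blast
  qed
  show ?thesis
  proof (cases "\<forall>a\<in>A. card {b \<in> A. ?\<kappa> b = ?\<kappa> a} \<le> d div 2")
    case True
    then obtain y \<sigma> where y: "y ` {..<d} = A" "\<sigma> ` {..<d} = {..<d}"
      "\<And>i. i < d \<Longrightarrow> \<sigma> i \<noteq> i" "\<And>i. i < d \<Longrightarrow> ?\<kappa> (y i) \<noteq> ?\<kappa> (y (\<sigma> i))"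
      using cyclic_pairing[OF A(1-3), of ?\<kappa>] by blast
    have "\<exists>c. linear_form I c (y i) = 0 \<and> linear_form I c (y (\<sigma> i)) = 0 \<and> linear_form I c q \<noteq> 0"
      if "i < d" for i using line[OF _ _ y(4)[OF that]] y(1,2) that by blast
    then obtain c where c: "\<And>i. i < d \<Longrightarrow> linear_form I (c i) (y i) = 0"
      "\<And>i. i < d \<Longrightarrow> linear_form I (c i) (y (\<sigma> i)) = 0" "\<And>i. i < d \<Longrightarrow> linear_form I (c i) q \<noteq> 0"
      by metis
    let ?F = "\<lambda>v. \<Prod>k<d. linear_form I (c k) v"
    have F: "?F \<in> forms I d" by (rule prod_linear_forms_in_forms[OF I])
    have "singular_form I ?F a" if a: "a \<in> A" for a
    proof -
      \<comment> \<open>The point occurs in the join started at position \<open>k\<close> and in the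
        one shifted onto \<open>k\<close>; since \<open>\<sigma>\<close> has no fixed position,
        these are two different factors.\<close>
      obtain k where k: "k < d" "a = y k" using a y(1) by blast
      then obtain k' where k': "k' < d" "k = \<sigma> k'" using y(2) by blast
      then have "k' \<noteq> k" using y(3) by metis
      then show ?thesis
        using prod_linear_forms_singular[OF I k(1) k'(1)] c(1)[OF k(1)] c(2)[OF k'(1)] k(2) k'(2) by metis
    qed
    moreover have "\<not> singular_form I ?F q"
      using c(3) A(3) by (intro nonsingular_if_nonzero[OF I F _ q(1)]) auto
    ultimately show ?thesis using F by blast
  next
    case False
    then obtain a0 where a0: "a0 \<in> A" "card {b \<in> A. ?\<kappa> b = ?\<kappa> a0} > d div 2" by fastforce
    define C where "C = {b \<in> A. ?\<kappa> b = ?\<kappa> a0}"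
    define B where "B = A - C"
    have CA: "C \<subseteq> A" and fin: "finite C" "finite B" using A(1) by (auto simp: C_def B_def)
    have "card A = card C + card B"
      using A(1) CA card_Diff_subset[OF fin(1) CA] card_mono[OF A(1) CA] by (simp add: B_def)
    then have cards: "d = card C + card B" "card C > d div 2" using A(2) a0(2) by (simp_all add: C_def)
    have C_line: "C \<subseteq> ?\<kappa> a0" unfolding C_def by (auto intro: cv.span_base)
    then have "B \<noteq> {}" using ncol[OF a0(1)] unfolding B_def by blast
    then have n: "card B \<ge> 1" using fin(2) by (simp add: Suc_leI card_gt_0_iff)
    obtain x where x: "bij_betw x {0..<card C} C" using ex_bij_betw_nat_finite[OF fin(1)] by blast
    obtain z where z: "bij_betw z {0..<card B} B" using ex_bij_betw_nat_finite[OF fin(2)] by blast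
    obtain b0 where b0: "b0 \<in> B" using \<open>B \<noteq> {}\<close> by blast
    have "b0 \<notin> ?\<kappa> a0"
    proof
      assume "b0 \<in> ?\<kappa> a0"
      moreover have "a0 \<noteq> 0" "b0 \<notin> cv.span {q}"
        using indep(1) a0(1) b0 cv.span_zero unfolding B_def by blast+
      ultimately have "?\<kappa> b0 = ?\<kappa> a0" by (intro span_pair_eq_iff)
      then show False using b0 unfolding B_def C_def by blast
    qed
    moreover have ca0: "{q, a0} \<subseteq> coord_space I" and cb0: "b0 \<in> coord_space I"
      using q(1) a0(1) A(4) b0 unfolding B_def by auto
    \<comment> \<open>\<open>H\<close> contains the crowded line but not \<open>b0\<close>, so
      \<open>b0\<close> serves as the direction in which the product has nonzero derivative at
      \<open>q\<close>.\<close>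
    ultimately obtain H where H: "\<And>v. v \<in> {q, a0} \<Longrightarrow> linear_form I H v = 0" "linear_form I H b0 \<noteq> 0"
      using separating_linear_form[OF I ca0 cb0] by blast
    have H0: "linear_form I H v = 0" if v: "v \<in> ?\<kappa> a0" for v
    proof -
      obtain s t where "v = cscale s q + cscale t a0" using v unfolding span_pair by blast
      then have "linear_form I H v = s * linear_form I H q + t * linear_form I H a0"
        by (simp add: linear_form_def distrib_left sum.distrib sum_distrib_left mult_ac)
      then show ?thesis using H(1) by simp
    qed
    have xC: "x (i mod card C) \<in> C" and zB: "z (i mod card B) \<in> B" for i
      using x z n cards unfolding bij_betw_def by auto
    \<comment> \<open>Running cyclically through \<open>C\<close> and \<open>B\<close> at once, the
      indices below \<open>d - 1\<close> meet each point of \<open>C\<close> at least once, and each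
      \<open>z j\<close> at both \<open>j\<close> and \<open>j + card B\<close>.\<close>
    have "\<exists>c. linear_form I c (x (i mod card C)) = 0 \<and> linear_form I c (z (i mod card B)) = 0 \<and>
        linear_form I c q \<noteq> 0" for i
      using xC[of i] zB[of i] by (intro line) (auto simp: B_def C_def)
    then obtain c' where c': "\<And>i. linear_form I (c' i) (x (i mod card C)) = 0"
      "\<And>i. linear_form I (c' i) (z (i mod card B)) = 0" "\<And>i. linear_form I (c' i) q \<noteq> 0" by metis
    \<comment> \<open>The last index is reserved for \<open>H\<close>, the only factor vanishing at
      \<open>q\<close>.\<close>
    define c where "c i = (if i = d - 1 then H else c' i)" for i
    let ?F = "\<lambda>v. \<Prod>k<d. linear_form I (c k) v"
    have "singular_form I ?F a" if a: "a \<in> A" for a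
    proof (cases "a \<in> C")
      case True
      then obtain j where j: "j < card C" "a = x j"
        using x atLeast0LessThan unfolding bij_betw_def by blast
      have "linear_form I (c (d - 1)) a = 0" using H0 C_line True by (auto simp: c_def)
      moreover have "j < d - 1" using j(1) n cards(1) by linarith
      moreover have "linear_form I (c j) a = 0" using c'(1)[of j] j calculation(2) by (simp add: c_def)
      ultimately show ?thesis
        using prod_linear_forms_singular[OF I, of j d "d - 1" c a] by simp
    next
      case False
      then have "a \<in> B" using a unfolding B_def by blast
      then obtain j where j: "j < card B" "a = z j"
        using z atLeast0LessThan unfolding bij_betw_def by blast
      have lt: "j + card B < d - 1" using j(1) cards by linarith
      have "linear_form I (c j) a = 0" using c'(2)[of j] j lt by (simp add: c_def)
      moreover have "linear_form I (c (j + card B)) a = 0"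
        using c'(2)[of "j + card B"] j lt by (simp add: c_def)
      ultimately show ?thesis
        using prod_linear_forms_singular[OF I, of j d "j + card B" c a] lt n by simp
    qed
    moreover have "\<not> singular_form I ?F q"
    proof (rule prod_linear_forms_nonsingular[OF I, of "d - 1" d b0 c])
      show "d - 1 < d" using A(3) by simp
      show "b0 \<in> coord_space I" by (rule cb0)
      show "linear_form I (c (d - 1)) b0 \<noteq> 0" "linear_form I (c (d - 1)) q = 0"
        using H by (auto simp: c_def)
      show "linear_form I (c k) q \<noteq> 0" if "k < d" "k \<noteq> d - 1" for k using that c'(3) by (simp add: c_def)
    qed
    ultimately show ?thesis using prod_linear_forms_in_forms[OF I] by blast
  qed
qed

section \<open>Tangent spaces and singular forms\<close>

definition singular_at :: "'i set \<Rightarrow> (('i \<Rightarrow> complex) \<Rightarrow> complex) \<Rightarrow> 'i point \<Rightarrow> bool" where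
  "singular_at I F p \<longleftrightarrow> (\<forall>v\<in>p. singular_form I F v)"

lemma singular_at_span:
  assumes "finite I" "F \<in> forms I d" shows "singular_at I F (cv.span {x}) \<longleftrightarrow> singular_form I F x"
proof
  assume "singular_at I F (cv.span {x})"
  then show "singular_form I F x" unfolding singular_at_def by (simp add: cv.span_base)
next
  assume "singular_form I F x"
  then show "singular_at I F (cv.span {x})"
    unfolding singular_at_def singular_form_def span_singleton by (auto simp: dir_deriv_scale[OF assms])
qed

text \<open>By duality this is the preimage of the contact locus under the Veronese map, which turns
  both base loci into questions about forms on projective space.\<close>

definition singular_closure :: "'i set \<Rightarrow> nat \<Rightarrow> 'i point set \<Rightarrow> 'i point set" where
  "singular_closure I d A = {q \<in> proj_space I.
     \<forall>F\<in>forms I d. (\<forall>p\<in>A. singular_at I F p) \<longrightarrow> singular_at I F q}"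

lemma representatives:
  assumes "A \<subseteq> proj_space I"
  obtains \<rho> where "\<And>p. p \<in> A \<Longrightarrow> \<rho> p \<in> coord_space I" "\<And>p. p \<in> A \<Longrightarrow> \<rho> p \<noteq> 0" "\<And>p. p \<in> A \<Longrightarrow> p = cv.span {\<rho> p}"
proof -
  have "\<forall>p\<in>A. \<exists>v. v \<in> coord_space I \<and> v \<noteq> 0 \<and> p = cv.span {v}"
    using assms unfolding proj_space_def projectivization_def by blast
  then show thesis using that by metis
qed

lemma double_span_eq:
  "double_span J X B = projectivization (cv.span (\<Union>p\<in>B. tangent_cone J X p))"
  unfolding double_span_def proj_span_def tangent_space_def
  by (simp only: span_Union_projectivization subspace_tangent_cone)

text \<open>This links the two loci: the condition on an extra point in
  \<open>strong_base_locus\<close> is the one that defines membership in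
  \<open>contact_locus\<close>.\<close>

lemma double_span_insert:
  "double_span J X (B \<union> {q}) = double_span J X B \<longleftrightarrow> tangent_space J X q \<subseteq> double_span J X B"
proof -
  let ?U = "\<Union>p\<in>B. tangent_cone J X p"
  have "double_span J X (B \<union> {q}) = double_span J X B \<longleftrightarrow> cv.span (?U \<union> tangent_cone J X q) = cv.span ?U"
    unfolding double_span_eq projectivization_eq_iff[OF cv.subspace_span cv.subspace_span]
    by (simp add: Un_commute)
  also have "\<dots> \<longleftrightarrow> tangent_cone J X q \<subseteq> cv.span ?U"
    unfolding cv.span_eq using cv.span_superset[of ?U] cv.span_superset[of "?U \<union> tangent_cone J X q"] by blast
  also have "\<dots> \<longleftrightarrow> tangent_space J X q \<subseteq> double_span J X B"
    unfolding double_span_eq tangent_space_def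
    by (rule projectivization_subset_iff[OF subspace_tangent_cone cv.subspace_span, symmetric])
  finally show ?thesis .
qed

lemma tangent_space_subset_proj_space: "tangent_space J X q \<subseteq> proj_space J"
  unfolding tangent_space_def proj_space_def projectivization_subset_iff[OF subspace_tangent_cone subspace_coord_space]
  by (auto simp: tangent_cone_def)

lemma tangent_space_subset_double_span_iff:
  assumes I: "finite I" and d: "d \<ge> 1" and A: "A \<subseteq> proj_space I" and q: "q \<in> proj_space I"
  shows "tangent_space (exponents I d) (veronese I d ` proj_space I) (veronese I d q) \<subseteq>
      double_span (exponents I d) (veronese I d ` proj_space I) (veronese I d ` A) \<longleftrightarrow>
    q \<in> singular_closure I d A"
proof -
  let ?T = "tangent_cone (exponents I d) (veronese I d ` proj_space I)"
  obtain \<rho> where \<rho>: "\<And>p. p \<in> A \<Longrightarrow> \<rho> p \<in> coord_space I" "\<And>p. p \<in> A \<Longrightarrow> \<rho> p \<noteq> 0" "\<And>p. p \<in> A \<Longrightarrow> p = cv.span {\<rho> p}"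
    using representatives[OF A] by blast
  obtain x where x: "x \<in> coord_space I" "x \<noteq> 0" "q = cv.span {x}"
    using q unfolding proj_space_def by (rule point_cases)
  have Tq: "?T (veronese I d q) = veronese_deriv I d x ` coord_space I"
    unfolding x(3) veronese_span by (rule tangent_cone_veronese[OF I d x(1,2)])
  have TA: "?T (veronese I d p) = veronese_deriv I d (\<rho> p) ` coord_space I" if "p \<in> A" for p
    using tangent_cone_veronese[OF I d \<rho>(1)[OF that] \<rho>(2)[OF that]] \<rho>(3)[OF that] veronese_span by metis
  have U: "(\<Union>p\<in>veronese I d ` A. ?T p) = (\<Union>y\<in>\<rho> ` A. veronese_deriv I d y ` coord_space I)"
    by (simp add: TA)
  have sA: "(\<forall>p\<in>A. singular_at I F p) \<longleftrightarrow> (\<forall>y\<in>\<rho> ` A. singular_form I F y)" if "F \<in> forms I d" for F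
    using \<rho>(3) singular_at_span[OF I that] by (metis (no_types, lifting) ball_imageD imageI image_iff)
  have "tangent_space (exponents I d) (veronese I d ` proj_space I) (veronese I d q) \<subseteq>
      double_span (exponents I d) (veronese I d ` proj_space I) (veronese I d ` A) \<longleftrightarrow>
      veronese_deriv I d x ` coord_space I \<subseteq> cv.span (\<Union>y\<in>\<rho> ` A. veronese_deriv I d y ` coord_space I)"
    unfolding tangent_space_def double_span_eq U[symmetric] Tq[symmetric]
    by (rule projectivization_subset_iff[OF subspace_tangent_cone cv.subspace_span])
  also have "\<dots> \<longleftrightarrow> (\<forall>F\<in>forms I d. (\<forall>y\<in>\<rho> ` A. singular_form I F y) \<longrightarrow> singular_form I F x)"
    by (rule veronese_deriv_subset_span_iff[OF I])
  also have "\<dots> \<longleftrightarrow> q \<in> singular_closure I d A"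
    unfolding singular_closure_def using q sA singular_at_span[OF I, of _ d x] x(3) by auto
  finally show ?thesis .
qed

section \<open>Forms singular along collinear and non-collinear sets\<close>

lemma proj_line_cases:
  assumes "proj_line I L"
  obtains v w where "v \<noteq> w" "cv.independent {v, w}" "cv.span {v, w} \<subseteq> coord_space I"
    "L = projectivization (cv.span {v, w})"
  using assms unfolding proj_line_def by (metis dim_2_obtain_basis)

lemma proj_lineI:
  assumes "v \<noteq> w" "cv.independent {v, w}" "v \<in> coord_space I" "w \<in> coord_space I"
  shows "proj_line I (projectivization (cv.span {v, w}))"
  unfolding proj_line_def
  using dim_span_pair[OF assms(1,2)] cv.span_minimal[OF _ subspace_coord_space, of "{v, w}" I] assms(3,4)
  by (intro exI[of _ "cv.span {v, w}"]) (simp add: cv.subspace_span)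

lemma proj_line_subset_proj_space:
  assumes "proj_line I L" shows "L \<subseteq> proj_space I"
  using assms unfolding proj_line_def proj_space_def projectivization_def by blast

lemma singular_closure_collinear:
  assumes I: "finite I" and d: "d \<ge> 2" and A: "finite A" "card A = d" and L: "proj_line I L" "A \<subseteq> L"
  shows "singular_closure I d A = L"
proof
  obtain v w where vw: "v \<noteq> w" "cv.independent {v, w}" "cv.span {v, w} \<subseteq> coord_space I"
    "L = projectivization (cv.span {v, w})" using L(1) by (rule proj_line_cases)
  show "L \<subseteq> singular_closure I d A"
  proof
    fix q assume qL: "q \<in> L"
    then obtain x where x: "x \<in> cv.span {v, w}" "q = cv.span {x}" unfolding vw(4) by (rule point_cases)
    have "singular_at I F q" if F: "F \<in> forms I d" "\<forall>p\<in>A. singular_at I F p" for F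
      unfolding x(2) singular_at_span[OF I F(1)] singular_form_def
    proof
      fix u assume u: "u \<in> coord_space I"
      show "dir_deriv I F x u = 0"
      proof (rule form_vanishes_on_line[OF I dir_deriv_in_forms[OF I F(1)] vw(1,2) A(1)])
        show "card A > d - 1" using A(2) d by simp
        show "A \<subseteq> projectivization (cv.span {v, w})" using L(2) vw(4) by simp
        show "vanishes_at (\<lambda>v. dir_deriv I F v u) p" if "p \<in> A" for p
          using F(2) that u unfolding singular_at_def singular_form_def vanishes_at_def by blast
      qed (rule x(1))
    qed
    moreover have "q \<in> proj_space I" using qL proj_line_subset_proj_space[OF L(1)] by blast
    ultimately show "q \<in> singular_closure I d A" unfolding singular_closure_def by blast
  qed
  show "singular_closure I d A \<subseteq> L"
  proof
    fix q assume q: "q \<in> singular_closure I d A"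
    then obtain x where x: "x \<in> coord_space I" "x \<noteq> 0" "q = cv.span {x}"
      unfolding singular_closure_def proj_space_def by (blast elim: point_cases)
    show "q \<in> L"
    proof (rule ccontr)
      assume "q \<notin> L"
      then have "x \<notin> cv.span {v, w}"
        unfolding vw(4) x(3) span_in_projectivization[OF cv.subspace_span x(2)] .
      moreover have "{v, w} \<subseteq> coord_space I" using vw(3) cv.span_superset[of "{v, w}"] by blast
      ultimately obtain c where c: "\<And>y. y \<in> {v, w} \<Longrightarrow> linear_form I c y = 0" "linear_form I c x \<noteq> 0"
        using separating_linear_form[OF I _ x(1)] by metis
      have c0: "linear_form I c y = 0" if y: "y \<in> cv.span {v, w}" for y
      proof -
        obtain s t where "y = cscale s v + cscale t w" using y unfolding span_pair by blast
        then have "linear_form I c y = s * linear_form I c v + t * linear_form I c w"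
          by (simp add: linear_form_def distrib_left sum.distrib sum_distrib_left mult_ac)
        then show ?thesis using c(1) by simp
      qed
      \<comment> \<open>The \<open>d\<close>-th power is written as a product to reuse the product
        lemmas with a constant family; \<open>d \<ge> 2\<close> provides the two vanishing factors,
        at positions 0 and 1.\<close>
      let ?F = "\<lambda>v. \<Prod>k<d. linear_form I c v"
      have F: "?F \<in> forms I d" by (rule prod_linear_forms_in_forms[OF I])
      have "singular_at I ?F p" if "p \<in> A" for p
      proof -
        have "p \<in> projectivization (cv.span {v, w})" using that L(2) vw(4) by blast
        then obtain y where y: "y \<in> cv.span {v, w}" "p = cv.span {y}" by (rule point_cases)
        show ?thesis unfolding y(2) singular_at_span[OF I F]
          using d c0[OF y(1)] prod_linear_forms_singular[OF I, of 0 d 1 "\<lambda>_. c" y] by simp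
      qed
      then have "singular_at I ?F q" using q F unfolding singular_closure_def by blast
      moreover have "\<not> singular_form I ?F x"
        using c(2) d by (intro nonsingular_if_nonzero[OF I F _ x(1)]) auto
      ultimately show False unfolding x(3) singular_at_span[OF I F] by blast
    qed
  qed
qed

lemma singular_closure_noncollinear:
  assumes I: "finite I" and d: "d \<ge> 2" and A: "finite A" "card A = d" "A \<subseteq> proj_space I"
    and ncol: "\<And>L. proj_line I L \<Longrightarrow> \<not> A \<subseteq> L"
  shows "singular_closure I d A = A"
proof
  show "A \<subseteq> singular_closure I d A" using A(3) unfolding singular_closure_def by blast
  show "singular_closure I d A \<subseteq> A"
  proof
    fix q assume q: "q \<in> singular_closure I d A"
    then obtain x where x: "x \<in> coord_space I" "x \<noteq> 0" "q = cv.span {x}"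
      unfolding singular_closure_def proj_space_def by (blast elim: point_cases)
    obtain \<rho> where \<rho>: "\<And>p. p \<in> A \<Longrightarrow> \<rho> p \<in> coord_space I" "\<And>p. p \<in> A \<Longrightarrow> \<rho> p \<noteq> 0"
      "\<And>p. p \<in> A \<Longrightarrow> p = cv.span {\<rho> p}" using representatives[OF A(3)] by blast
    have inj: "inj_on \<rho> A" using \<rho>(3) by (metis inj_onI)
    have not_span: "a \<notin> cv.span {b}" if "cv.span {a} \<noteq> cv.span {b}" "a \<noteq> 0" for a b :: "'a \<Rightarrow> complex"
    proof
      assume "a \<in> cv.span {b}"
      then obtain c where c: "a = cscale c b" unfolding span_singleton by blast
      then have "c \<noteq> 0" using that(2) by (auto simp: fun_eq_iff)
      then show False using that(1) c span_scale_nonzero by blast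
    qed
    show "q \<in> A"
    proof (rule ccontr)
      assume qA: "q \<notin> A"
      then have neq: "cv.span {\<rho> p} \<noteq> cv.span {x}" if "p \<in> A" for p using \<rho>(3)[OF that] x(3) that by metis
      have "\<exists>F\<in>forms I d. (\<forall>a\<in>\<rho> ` A. singular_form I F a) \<and> \<not> singular_form I F x"
      proof (rule noncollinear_separating_form[OF I _ _ d _ x(1,2)])
        show "finite (\<rho> ` A)" "card (\<rho> ` A) = d" "\<rho> ` A \<subseteq> coord_space I"
          using A \<rho>(1) inj by (auto simp: card_image)
        fix a assume "a \<in> \<rho> ` A"
        then obtain p where p: "p \<in> A" "a = \<rho> p" by blast
        show a: "a \<notin> cv.span {x}" using not_span[OF neq[OF p(1)] \<rho>(2)[OF p(1)]] p(2) by simp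
        show "x \<notin> cv.span {a}" using not_span[OF neq[OF p(1), symmetric] x(2)] p(2) by simp
        show "\<not> \<rho> ` A \<subseteq> cv.span {x, a}"
        proof
          \<comment> \<open>Only lines through the point \<open>q\<close> and a point of
            \<open>A\<close> matter; \<open>A\<close> on such a line would be collinear.\<close>
          assume sub: "\<rho> ` A \<subseteq> cv.span {x, a}"
          have "A \<subseteq> projectivization (cv.span {x, a})"
            using sub \<rho>(2,3) unfolding projectivization_def by blast
          moreover have "proj_line I (projectivization (cv.span {x, a}))"
            using a x(1,2) \<rho>(1)[OF p(1)] p(2) independent_pair_iff[of x a] by (intro proj_lineI) auto
          ultimately show False using ncol by blast
        qed
      qed
      then obtain F where F: "F \<in> forms I d" "\<forall>a\<in>\<rho> ` A. singular_form I F a" "\<not> singular_form I F x" by blast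
      have "singular_at I F p" if "p \<in> A" for p
        using F(2) that \<rho>(3)[OF that] singular_at_span[OF I F(1)] by (metis imageI)
      then have "singular_at I F q" using q F(1) unfolding singular_closure_def by blast
      then show False using F(3) unfolding x(3) singular_at_span[OF I F(1)] by blast
    qed
  qed
qed

section \<open>Rational normal curves\<close>

text \<open>Substituting linear forms into a monomial of degree \<open>d\<close> gives a form of
  degree \<open>d\<close>, hence a linear combination of the new monomials. This is the
  \<open>d\<close>-th symmetric power of a linear map, in coordinates.\<close>

lemma induced_veronese_map:
  fixes I :: "'i set" and I' :: "'k set"
  assumes I: "finite I" and I': "finite I'" and l: "\<And>i. i \<in> I \<Longrightarrow> l i \<in> forms I' 1"
  obtains \<phi> where "Vector_Spaces.linear cscale cscale \<phi>" "\<And>z. \<phi> z \<in> coord_space (exponents I d)"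
    "\<And>y. \<phi> (veronese_vec I' d y) = veronese_vec I d (\<lambda>i. if i \<in> I then l i y else 0)"
proof -
  let ?M = "\<lambda>y i. if i \<in> I then l i y else 0"
  have "\<exists>c. \<forall>y. monomial I m (?M y) = (\<Sum>e\<in>exponents I' d. c e * monomial I' e y)"
    if m: "m \<in> exponents I d" for m
  proof -
    have "(\<lambda>y. \<Prod>i\<in>I. l i y ^ m i) \<in> forms I' (\<Sum>i\<in>I. m i * 1)"
      using l by (intro forms_prod forms_power I I') auto
    also have "(\<Sum>i\<in>I. m i * 1) = d" using m by (simp add: exponents_def)
    finally obtain c where "(\<lambda>y. \<Prod>i\<in>I. l i y ^ m i) = (\<lambda>y. \<Sum>e\<in>exponents I' d. c e * monomial I' e y)"
      unfolding forms_def by blast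
    then have "\<forall>y. (\<Prod>i\<in>I. l i y ^ m i) = (\<Sum>e\<in>exponents I' d. c e * monomial I' e y)" by metis
    moreover have "monomial I m (?M y) = (\<Prod>i\<in>I. l i y ^ m i)" for y
      unfolding monomial_def by (intro prod.cong) auto
    ultimately show ?thesis by auto
  qed
  then have "\<forall>m\<in>exponents I d. \<exists>c. \<forall>y. monomial I m (?M y) = (\<Sum>e\<in>exponents I' d. c e * monomial I' e y)" ..
  from bchoice[OF this] obtain c where c: "\<And>m y. m \<in> exponents I d \<Longrightarrow>
      monomial I m (?M y) = (\<Sum>e\<in>exponents I' d. c m e * monomial I' e y)" by blast
  define \<phi> where "\<phi> z = (\<lambda>m. if m \<in> exponents I d then \<Sum>e\<in>exponents I' d. c m e * z e else 0)"
    for z :: "('k \<Rightarrow> nat) \<Rightarrow> complex"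
  show thesis
  proof (rule that[of \<phi>])
    show "Vector_Spaces.linear cscale cscale \<phi>"
      by (intro linear_cscaleI)
        (auto simp: \<phi>_def fun_eq_iff distrib_left sum.distrib sum_distrib_left mult_ac)
    show "\<phi> z \<in> coord_space (exponents I d)" for z by (simp add: \<phi>_def coord_space_def)
    show "\<phi> (veronese_vec I' d y) = veronese_vec I d (?M y)" for y
      by (rule ext) (simp add: \<phi>_def veronese_vec_def c)
  qed
qed

text \<open>A functional killing all Veronese vectors, evaluated at the points with coordinates 1
  and \<open>t\<close>, is a polynomial in \<open>t\<close> with the same coefficients. It has every
  \<open>t\<close> as a root, so it is zero.\<close>

lemma span_veronese_line:
  "coord_space (exponents {..1} d) \<subseteq> cv.span (veronese_vec {..1::nat} d ` coord_space {..1})"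
proof (rule ccontr)
  let ?E = "exponents {..1::nat} d"
  assume "\<not> ?thesis"
  then obtain z where z: "z \<in> coord_space ?E" "z \<notin> cv.span (veronese_vec {..1} d ` coord_space {..1})" by blast
  have E: "finite ?E" by (intro finite_exponents) simp
  have "cv.span (veronese_vec {..1} d ` coord_space {..1}) \<subseteq> coord_space ?E"
    using veronese_vec_in_coord_space by (intro cv.span_minimal subspace_coord_space) blast
  from separating_functional[OF E cv.subspace_span this z]
  obtain c where c: "\<And>y. y \<in> cv.span (veronese_vec {..1} d ` coord_space {..1}) \<Longrightarrow> (\<Sum>e\<in>?E. c e * y e) = 0"
    "(\<Sum>e\<in>?E. c e * z e) \<noteq> 0" by blast
  define P where "P = (\<Sum>e\<in>?E. Polynomial.monom (c e) (e 1))"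
  have "poly P t = 0" for t
  proof -
    let ?y = "\<lambda>i::nat. if i = 0 then 1 else if i = 1 then t else 0"
    have mono: "monomial {..1} e ?y = t ^ e 1" for e by (simp add: monomial_def)
    have "?y \<in> coord_space {..1}" by (simp add: coord_space_def)
    then have "(\<Sum>e\<in>?E. c e * veronese_vec {..1} d ?y e) = 0" by (intro c(1) cv.span_base) blast
    also have "(\<Sum>e\<in>?E. c e * veronese_vec {..1} d ?y e) = poly P t"
      unfolding P_def poly_sum by (intro sum.cong) (simp_all only: veronese_vec_apply mono poly_monom)
    finally show ?thesis .
  qed
  then have "P = 0" using poly_all_0_iff_0 by blast
  have "c e = 0" if e: "e \<in> ?E" for e
  proof -
    \<comment> \<open>The two exponents add up to \<open>d\<close>, so distinct monomials contribute
      to distinct powers of \<open>t\<close>.\<close>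
    have det: "e' = e" if "e' \<in> ?E" "e' 1 = e 1" for e'
    proof
      fix i
      have "e' 0 + e' 1 = d" "e 0 + e 1 = d" using that(1) e by (auto simp: exponents_def)
      then show "e' i = e i"
        using that e by (cases "i = 0"; cases "i = 1") (auto simp: exponents_def)
    qed
    have "coeff P (e 1) = (\<Sum>e'\<in>?E. if e' 1 = e 1 then c e' else 0)"
      by (simp add: P_def coeff_sum)
    also have "\<dots> = (\<Sum>e'\<in>?E. if e' = e then c e' else 0)"
      using det by (intro sum.cong) auto
    also have "\<dots> = c e" using E e by (simp add: sum.delta)
    finally show ?thesis using \<open>P = 0\<close> by simp
  qed
  then show False using c(2) by simp
qed

text \<open>A linear parametrization \<open>M\<close> of the cone over the line induces
  \<open>\<phi>\<close>, and a left inverse \<open>N\<close> of \<open>M\<close> induces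
  \<open>\<psi>\<close>. Their composition fixes the Veronese vectors, which span, so
  \<open>\<phi>\<close> is injective on the whole coordinate space.\<close>

lemma rational_normal_curve_veronese_line:
  assumes I: "finite I" and L: "proj_line I L"
  shows "rational_normal_curve (exponents I d) d (veronese I d ` L)"
proof -
  obtain v w where vw: "v \<noteq> w" "cv.independent {v, w}" "cv.span {v, w} \<subseteq> coord_space I"
    "L = projectivization (cv.span {v, w})" using L by (rule proj_line_cases)
  have vI: "v \<in> coord_space I" "w \<in> coord_space I"
    using vw(3) cv.span_superset[of "{v, w}"] by blast+
  have indep: "v \<notin> cv.span {w}" "w \<notin> cv.span {v}"
    using vw(1,2) independent_pair_iff[of v w] independent_pair_iff[of w v] by (auto simp: insert_commute)
  have dual: "\<exists>c. linear_form I c y = 0 \<and> linear_form I c x = 1"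
    if xy: "x \<notin> cv.span {y}" "x \<in> coord_space I" "y \<in> coord_space I" for x y
  proof -
    obtain c where c: "\<And>v. v \<in> {y} \<Longrightarrow> linear_form I c v = 0" "linear_form I c x \<noteq> 0"
      using separating_linear_form[OF I _ xy(2,1)] xy(3) by blast
    have "linear_form I (\<lambda>i. c i / linear_form I c x) u = linear_form I c u / linear_form I c x" for u
      by (simp add: linear_form_def sum_divide_distrib)
    then show ?thesis using c by (intro exI[of _ "\<lambda>i. c i / linear_form I c x"]) simp
  qed
  obtain \<alpha> \<beta> where \<alpha>: "linear_form I \<alpha> w = 0" "linear_form I \<alpha> v = 1"
    and \<beta>: "linear_form I \<beta> v = 0" "linear_form I \<beta> w = 1" using dual indep vI by metis
  define M where "M y = cscale (y 0) v + cscale (y (1::nat)) w" for y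
  \<comment> \<open>\<open>\<alpha>\<close> and \<open>\<beta>\<close> are dual to \<open>v\<close>
    and \<open>w\<close>, so they read off the two parameters of \<open>M y\<close>.\<close>
  define N where "N x = (\<lambda>k. if k \<in> {..1::nat} then linear_form I (if k = 0 then \<alpha> else \<beta>) x else 0)" for x
  define l where "l i = linear_form {..1::nat} (\<lambda>k. if k = 0 then v i else w i)" for i
  have l: "l i \<in> forms {..1} 1" if "i \<in> I" for i unfolding l_def by (intro linear_form_in_forms) simp
  obtain \<phi> where \<phi>: "Vector_Spaces.linear cscale cscale \<phi>" "\<And>z. \<phi> z \<in> coord_space (exponents I d)"
    "\<And>y. \<phi> (veronese_vec {..1::nat} d y) = veronese_vec I d (\<lambda>i. if i \<in> I then l i y else 0)"
    using induced_veronese_map[of I "{..1}" l d] I l by blast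
  have "(\<lambda>i. if i \<in> I then l i y else 0) = M y" for y
    using vI by (auto simp: M_def l_def fun_eq_iff linear_form_def coord_space_def)
  then have \<phi>M: "\<phi> (veronese_vec {..1} d y) = veronese_vec I d (M y)" for y using \<phi>(3) by simp
  define l' where "l' k = linear_form I (if k = 0 then \<alpha> else \<beta>)" for k :: nat
  have l': "l' k \<in> forms I 1" if "k \<in> {..1}" for k unfolding l'_def by (rule linear_form_in_forms[OF I])
  have N: "N x = (\<lambda>k. if k \<in> {..1} then l' k x else 0)" for x unfolding N_def l'_def ..
  obtain \<psi> where \<psi>: "Vector_Spaces.linear cscale cscale \<psi>"
    "\<And>z. \<psi> z \<in> coord_space (exponents {..1::nat} d)"
    "\<And>x. \<psi> (veronese_vec I d x) = veronese_vec {..1::nat} d (\<lambda>k. if k \<in> {..1} then l' k x else 0)"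
    using induced_veronese_map[of "{..1}" I l' d] I l' by blast
  have \<psi>N: "\<psi> (veronese_vec I d x) = veronese_vec {..1} d (N x)" for x unfolding N by (rule \<psi>(3))
  interpret \<phi>: Vector_Spaces.linear cscale cscale \<phi> by (rule \<phi>(1))
  interpret \<psi>: Vector_Spaces.linear cscale cscale \<psi> by (rule \<psi>(1))
  have lin: "linear_form I c (M y) = y 0 * linear_form I c v + y 1 * linear_form I c w" for c y
    by (simp add: M_def linear_form_def distrib_left sum.distrib sum_distrib_left mult_ac)
  have NM: "N (M y) = y" if "y \<in> coord_space {..1}" for y
  proof
    fix k show "N (M y) k = y k"
      using that \<alpha> \<beta> by (cases "k = 0"; cases "k = 1") (auto simp: N_def lin coord_space_def)
  qed
  have "cv.span (veronese_vec {..1} d ` coord_space {..1}) \<subseteq> {z. \<psi> (\<phi> z) = z}"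
  proof (rule cv.span_minimal)
    show "veronese_vec {..1} d ` coord_space {..1} \<subseteq> {z. \<psi> (\<phi> z) = z}"
      by (intro image_subsetI) (simp only: mem_Collect_eq \<phi>M \<psi>N NM)
    show "cv.subspace {z. \<psi> (\<phi> z) = z}"
      by (intro cv.subspaceI)
        (simp_all only: mem_Collect_eq \<phi>.zero \<psi>.zero \<phi>.add \<psi>.add \<phi>.scale \<psi>.scale)
  qed
  then have id: "\<psi> (\<phi> z) = z" if "z \<in> coord_space (exponents {..1} d)" for z
    using span_veronese_line that by blast
  have Mspan: "M y \<in> cv.span {v, w}" for y unfolding M_def span_pair by blast
  have M0: "M y \<noteq> 0" if "y \<in> coord_space {..1}" "y \<noteq> 0" for y
  proof
    assume "M y = 0"
    moreover have "N 0 = 0" unfolding N_def by (rule ext) (simp add: linear_form_def)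
    ultimately have "N (M y) = 0" by metis
    then show False using NM that by metis
  qed
  have img: "\<phi> ` veronese {..1} d (cv.span {y}) = veronese I d (cv.span {M y})" for y
    unfolding veronese_span \<phi>.span_image[symmetric] image_insert image_empty \<phi>M ..
  have "(\<lambda>p. \<phi> ` p) ` veronese_variety 1 d = veronese I d ` L"
  proof (intro subset_antisym subsetI)
    fix r assume "r \<in> (\<lambda>p. \<phi> ` p) ` veronese_variety 1 d"
    then obtain y where "y \<in> coord_space {..1}" "y \<noteq> 0" "r = veronese I d (cv.span {M y})"
      unfolding veronese_variety_def proj_space_def projectivization_def using img by blast
    then show "r \<in> veronese I d ` L"
      unfolding vw(4) using Mspan M0 by (auto simp: projectivization_def)
  next
    fix r assume "r \<in> veronese I d ` L"
    then obtain p where p: "p \<in> L" "r = veronese I d p" by blast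
    then obtain x where x: "x \<in> cv.span {v, w}" "x \<noteq> 0" "p = cv.span {x}"
      unfolding vw(4) by (blast elim: point_cases)
    then obtain s t where st: "x = cscale s v + cscale t w" unfolding span_pair by blast
    define y where "y = (\<lambda>i::nat. if i = 0 then s else if i = 1 then t else 0)"
    have y: "y \<in> coord_space {..1}" by (simp add: y_def coord_space_def)
    have My: "M y = x" unfolding M_def y_def st by simp
    have "y \<noteq> 0"
    proof
      assume "y = 0"
      then have "M y = 0" by (simp add: M_def fun_eq_iff)
      then show False using My x(2) by simp
    qed
    then have "cv.span {y} \<in> proj_space {..1}" using y span_in_proj_space by blast
    then have "veronese {..1} d (cv.span {y}) \<in> veronese_variety 1 d" unfolding veronese_variety_def by blast
    then show "r \<in> (\<lambda>p. \<phi> ` p) ` veronese_variety 1 d" using img[of y] p(2) x(3) My by (metis image_eqI)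
  qed
  moreover have "inj_on \<phi> (coord_space (exponents {..1} d))" using id by (rule inj_on_inverseI[where g = \<psi>])
  moreover have "\<phi> ` coord_space (exponents {..1} d) \<subseteq> coord_space (exponents I d)" using \<phi>(2) by blast
  ultimately show ?thesis
    unfolding rational_normal_curve_def using \<phi>(1) by (intro exI[of _ \<phi>] conjI) simp_all
qed

section \<open>Strong base loci and contact loci of Veronese varieties\<close>

text \<open>Three unit vectors do not fit into a two-dimensional space; this is where
  \<open>n \<ge> 2\<close> enters. A point off the line is what later shows that the double span is
  proper.\<close>

lemma proj_line_neq_plane:
  fixes L :: "nat point set"
  assumes n: "n \<ge> 2" and L: "proj_line {..n} L" obtains q where "q \<in> proj_space {..n}" "q \<notin> L"
proof -
  obtain v w where vw: "v \<noteq> w" "cv.independent {v, w}" "L = projectivization (cv.span {v, w})"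
    using L by (rule proj_line_cases)
  define e where "e k = (\<lambda>i::nat. if i = k then 1 else 0 :: complex)" for k
  have e_neq: "e 0 \<noteq> e 1" "e 0 \<noteq> e 2" "e 1 \<noteq> e 2" "e 1 \<noteq> 0" by (auto simp: e_def fun_eq_iff)
  have "e 2 \<notin> cv.span {e 1}"
  proof
    assume "e 2 \<in> cv.span {e 1}"
    then obtain c where "e 2 = cscale c (e 1)" unfolding span_singleton by blast
    from fun_cong[OF this, of 2] show False by (simp add: e_def)
  qed
  then have "cv.independent {e 1, e 2}" using independent_pair_iff e_neq by blast
  moreover have "e 0 \<notin> cv.span {e 1, e 2}"
  proof
    assume "e 0 \<in> cv.span {e 1, e 2}"
    then obtain a b where "e 0 = cscale a (e 1) + cscale b (e 2)" unfolding span_pair by blast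
    from fun_cong[OF this, of 0] show False by (simp add: e_def)
  qed
  ultimately have ind: "cv.independent {e 0, e 1, e 2}"
    using e_neq cv.independent_insert[of "e 0" "{e 1, e 2}"] by auto
  have "\<not> coord_space {..n} \<subseteq> cv.span {v, w}"
  proof
    assume sub: "coord_space {..n} \<subseteq> cv.span {v, w}"
    have "{e 0, e 1, e 2} \<subseteq> coord_space {..n}" using n by (auto simp: e_def coord_space_def)
    then have "card {e 0, e 1, e 2} \<le> card {v, w}"
      using cv.independent_span_bound[OF _ ind, of "{v, w}"] sub by auto
    then show False using e_neq vw(1) by simp
  qed
  then obtain x where x: "x \<in> coord_space {..n}" "x \<notin> cv.span {v, w}" by blast
  have "x \<noteq> 0" using x(2) cv.span_zero by metis
  then show thesis
    using that[of "cv.span {x}"] x vw(3) span_in_proj_space span_in_projectivization[OF cv.subspace_span] by metis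
qed

text \<open>The alternative that no point of projective space meets the dimension equation of
  \<open>smooth_locus\<close> is treated separately in the final proof.\<close>

context
  fixes n d :: nat
  assumes d: "d \<ge> 2" and n: "n \<ge> 2"
    and smooth: "smooth_locus {..n} (proj_space {..n}) = proj_space {..n}"
begin

lemma smooth_locus_veronese_variety: "smooth_locus (exponents {..n} d) (veronese_variety n d) = veronese_variety n d"
  unfolding veronese_variety_def using d by (simp add: smooth_locus_veronese smooth)

lemma smooth_sets_proj_space:
  "A \<in> smooth_sets {..n} d (proj_space {..n}) \<longleftrightarrow> A \<subseteq> proj_space {..n} \<and> finite A \<and> card A = d"
  unfolding smooth_sets_def smooth by blast

lemma smooth_sets_veronese_variety:
  "smooth_sets (exponents {..n} d) d (veronese_variety n d) =
    (\<lambda>A. veronese {..n} d ` A) ` smooth_sets {..n} d (proj_space {..n})"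
proof -
  have inj: "inj_on (veronese {..n} d) (proj_space {..n})" using d by (intro inj_on_veronese) auto
  show ?thesis
  proof (intro subset_antisym subsetI)
    fix B assume "B \<in> smooth_sets (exponents {..n} d) d (veronese_variety n d)"
    then have B: "B \<subseteq> veronese {..n} d ` proj_space {..n}" "finite B" "card B = d"
      unfolding smooth_sets_def smooth_locus_veronese_variety by (simp_all add: veronese_variety_def)
    then obtain A where A: "A \<subseteq> proj_space {..n}" "B = veronese {..n} d ` A" by (meson subset_imageE)
    have "inj_on (veronese {..n} d) A" using inj A(1) by (rule inj_on_subset)
    then have "finite A" "card A = d" using B(2,3) unfolding A(2) by (auto simp: card_image dest: finite_imageD)
    then show "B \<in> (\<lambda>A. veronese {..n} d ` A) ` smooth_sets {..n} d (proj_space {..n})"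
      using A smooth_sets_proj_space by blast
  next
    fix B assume "B \<in> (\<lambda>A. veronese {..n} d ` A) ` smooth_sets {..n} d (proj_space {..n})"
    then obtain A where A: "A \<subseteq> proj_space {..n}" "finite A" "card A = d" "B = veronese {..n} d ` A"
      unfolding image_iff Bex_def smooth_sets_proj_space by blast
    have "inj_on (veronese {..n} d) A" using inj A(1) by (rule inj_on_subset)
    then show "B \<in> smooth_sets (exponents {..n} d) d (veronese_variety n d)"
      using A unfolding smooth_sets_def smooth_locus_veronese_variety
      by (auto simp: card_image veronese_variety_def)
  qed
qed

lemma contact_locus_veronese:
  assumes "A \<subseteq> proj_space {..n}"
  shows "contact_locus (exponents {..n} d) (veronese_variety n d) (veronese {..n} d ` A) =
    veronese {..n} d ` singular_closure {..n} d A"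
  using tangent_space_subset_double_span_iff[of "{..n}" d A] d assms
  unfolding contact_locus_def smooth_locus_veronese_variety
  unfolding veronese_variety_def singular_closure_def by auto

lemma double_span_veronese_insert:
  assumes "A \<subseteq> proj_space {..n}" "q \<in> proj_space {..n}"
  shows "double_span (exponents {..n} d) (veronese_variety n d) (veronese {..n} d ` A \<union> {veronese {..n} d q}) =
     double_span (exponents {..n} d) (veronese_variety n d) (veronese {..n} d ` A) \<longleftrightarrow>
     q \<in> singular_closure {..n} d A"
  unfolding double_span_insert veronese_variety_def using d assms
  by (intro tangent_space_subset_double_span_iff) auto

text \<open>The closure is the line \<open>L\<close>. A point off \<open>L\<close> has tangent space
  outside the double span, which is therefore proper; and \<open>L\<close>, being infinite, has a
  point outside \<open>A\<close> that can be added without enlarging the span.\<close>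

lemma veronese_base_loci_collinear:
  assumes A: "A \<in> smooth_sets {..n} d (proj_space {..n})" and L: "proj_line {..n} L" "A \<subseteq> L"
  shows "veronese {..n} d ` A \<in> strong_base_locus (exponents {..n} d) d (veronese_variety n d)"
    and "veronese {..n} d ` A \<in> contact_base_locus (exponents {..n} d) d (veronese_variety n d)"
    and "contact_locus (exponents {..n} d) (veronese_variety n d) (veronese {..n} d ` A) = veronese {..n} d ` L"
proof -
  have A': "A \<subseteq> proj_space {..n}" "finite A" "card A = d" using A smooth_sets_proj_space by blast+
  have LP: "L \<subseteq> proj_space {..n}" by (rule proj_line_subset_proj_space[OF L(1)])
  have cl: "singular_closure {..n} d A = L"
    using d by (intro singular_closure_collinear A' L) auto
  show contact: "contact_locus (exponents {..n} d) (veronese_variety n d) (veronese {..n} d ` A) = veronese {..n} d ` L"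
    using contact_locus_veronese[OF A'(1)] cl by simp
  have inj: "inj_on (veronese {..n} d) (proj_space {..n})" using d by (intro inj_on_veronese) auto
  have B: "veronese {..n} d ` A \<in> smooth_sets (exponents {..n} d) d (veronese_variety n d)"
    using A smooth_sets_veronese_variety by blast
  obtain v w where vw: "v \<noteq> w" "cv.independent {v, w}" "cv.span {v, w} \<subseteq> coord_space {..n}"
    "L = projectivization (cv.span {v, w})" using L(1) by (rule proj_line_cases)
  obtain q where q: "q \<in> proj_space {..n}" "q \<notin> L" using proj_line_neq_plane[OF n L(1)] .
  have "\<not> tangent_space (exponents {..n} d) (veronese_variety n d) (veronese {..n} d q) \<subseteq>
      double_span (exponents {..n} d) (veronese_variety n d) (veronese {..n} d ` A)"
    using double_span_veronese_insert[OF A'(1) q(1)] q(2) cl unfolding double_span_insert by blast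
  then have proper: "double_span (exponents {..n} d) (veronese_variety n d) (veronese {..n} d ` A) \<noteq>
      proj_space (exponents {..n} d)"
    using tangent_space_subset_proj_space by metis
  have "\<not> L \<subseteq> A" using infinite_proj_line[OF vw(1,2)] A'(2) vw(4) finite_subset by metis
  then obtain r where r: "r \<in> L" "r \<notin> A" by blast
  have "veronese {..n} d r \<notin> veronese {..n} d ` A"
    using inj_on_image_mem_iff[OF inj _ A'(1)] r LP by blast
  moreover have "veronese {..n} d r \<in> veronese_variety n d" using r(1) LP unfolding veronese_variety_def by blast
  moreover have "double_span (exponents {..n} d) (veronese_variety n d) (veronese {..n} d ` A \<union> {veronese {..n} d r}) =
     double_span (exponents {..n} d) (veronese_variety n d) (veronese {..n} d ` A)"
    using double_span_veronese_insert[OF A'(1)] r(1) LP cl by blast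
  ultimately show "veronese {..n} d ` A \<in> strong_base_locus (exponents {..n} d) d (veronese_variety n d)"
    unfolding strong_base_locus_def smooth_locus_veronese_variety using B proper by blast
  have "proj_dim (exponents {..n} d) (veronese {..n} d ` L) > 0"
    unfolding vw(4) using d by (intro veronese_line_dim_pos vw) auto
  then show "veronese {..n} d ` A \<in> contact_base_locus (exponents {..n} d) d (veronese_variety n d)"
    unfolding contact_base_locus_def using B proper contact by simp
qed

text \<open>The closure is \<open>A\<close> itself: no further point can be added without enlarging
  the span, and the contact locus is a finite set, of dimension 0.\<close>

lemma veronese_base_loci_noncollinear:
  assumes A: "A \<in> smooth_sets {..n} d (proj_space {..n})" and ncol: "\<And>L. proj_line {..n} L \<Longrightarrow> \<not> A \<subseteq> L"
  shows "veronese {..n} d ` A \<notin> strong_base_locus (exponents {..n} d) d (veronese_variety n d)"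
    and "veronese {..n} d ` A \<notin> contact_base_locus (exponents {..n} d) d (veronese_variety n d)"
proof -
  have A': "A \<subseteq> proj_space {..n}" "finite A" "card A = d" using A smooth_sets_proj_space by blast+
  have cl: "singular_closure {..n} d A = A"
    using d by (intro singular_closure_noncollinear A' ncol) auto
  show "veronese {..n} d ` A \<notin> strong_base_locus (exponents {..n} d) d (veronese_variety n d)"
  proof
    assume "veronese {..n} d ` A \<in> strong_base_locus (exponents {..n} d) d (veronese_variety n d)"
    then obtain y where y: "y \<in> veronese_variety n d" "y \<notin> veronese {..n} d ` A"
      "double_span (exponents {..n} d) (veronese_variety n d) (veronese {..n} d ` A \<union> {y}) =
       double_span (exponents {..n} d) (veronese_variety n d) (veronese {..n} d ` A)"
      unfolding strong_base_locus_def smooth_locus_veronese_variety by blast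
    then obtain q where "q \<in> proj_space {..n}" "y = veronese {..n} d q" unfolding veronese_variety_def by blast
    then show False using y(2,3) double_span_veronese_insert[OF A'(1)] cl by blast
  qed
  have "proj_dim (exponents {..n} d) (veronese {..n} d ` A) = 0"
    unfolding proj_dim_def
  proof (rule krull_dim_finite_t1)
    show "t1_space (subtopology (zariski (exponents {..n} d)) (veronese {..n} d ` A))"
      by (intro t1_space_subtopology t1_space_zariski finite_exponents) simp
    show "finite (topspace (subtopology (zariski (exponents {..n} d)) (veronese {..n} d ` A)))"
      using A'(2) by (simp add: topspace_subtopology)
  qed
  then show "veronese {..n} d ` A \<notin> contact_base_locus (exponents {..n} d) d (veronese_variety n d)"
    unfolding contact_base_locus_def using contact_locus_veronese[OF A'(1)] cl by simp
qed

lemma veronese_base_loci_eq: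
  "strong_base_locus (exponents {..n} d) d (veronese_variety n d) =
     {veronese {..n} d ` A | A. A \<in> smooth_sets {..n} d (proj_space {..n}) \<and> (\<exists>L. proj_line {..n} L \<and> A \<subseteq> L)}"
  "contact_base_locus (exponents {..n} d) d (veronese_variety n d) =
     {veronese {..n} d ` A | A. A \<in> smooth_sets {..n} d (proj_space {..n}) \<and> (\<exists>L. proj_line {..n} L \<and> A \<subseteq> L)}"
proof -
  \<comment> \<open>Both loci are images of \<open>d\<close>-point sets, so each is determined by
    containing the collinear ones and omitting the others; this is proved once for an arbitrary such
    \<open>S\<close>.\<close>
  have eq: "S = {veronese {..n} d ` A | A. A \<in> smooth_sets {..n} d (proj_space {..n}) \<and> (\<exists>L. proj_line {..n} L \<and> A \<subseteq> L)}"
    if S: "S \<subseteq> (\<lambda>A. veronese {..n} d ` A) ` smooth_sets {..n} d (proj_space {..n})"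
      and col: "\<And>A L. A \<in> smooth_sets {..n} d (proj_space {..n}) \<Longrightarrow> proj_line {..n} L \<Longrightarrow> A \<subseteq> L \<Longrightarrow>
        veronese {..n} d ` A \<in> S"
      and ncol: "\<And>A. A \<in> smooth_sets {..n} d (proj_space {..n}) \<Longrightarrow>
        (\<And>L. proj_line {..n} L \<Longrightarrow> \<not> A \<subseteq> L) \<Longrightarrow> veronese {..n} d ` A \<notin> S" for S
  proof (intro subset_antisym subsetI CollectI)
    fix B assume "B \<in> S"
    then obtain A where A: "A \<in> smooth_sets {..n} d (proj_space {..n})" "B = veronese {..n} d ` A" using S by blast
    then have "\<exists>L. proj_line {..n} L \<and> A \<subseteq> L" using ncol \<open>B \<in> S\<close> by blast
    then show "\<exists>A. B = veronese {..n} d ` A \<and> A \<in> smooth_sets {..n} d (proj_space {..n}) \<and>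
        (\<exists>L. proj_line {..n} L \<and> A \<subseteq> L)" using A by blast
  qed (use col in blast)
  have sub: "strong_base_locus (exponents {..n} d) d (veronese_variety n d) \<subseteq>
      (\<lambda>A. veronese {..n} d ` A) ` smooth_sets {..n} d (proj_space {..n})"
    "contact_base_locus (exponents {..n} d) d (veronese_variety n d) \<subseteq>
      (\<lambda>A. veronese {..n} d ` A) ` smooth_sets {..n} d (proj_space {..n})"
    unfolding strong_base_locus_def contact_base_locus_def smooth_sets_veronese_variety by blast+
  show "strong_base_locus (exponents {..n} d) d (veronese_variety n d) =
     {veronese {..n} d ` A | A. A \<in> smooth_sets {..n} d (proj_space {..n}) \<and> (\<exists>L. proj_line {..n} L \<and> A \<subseteq> L)}"
    by (rule eq[OF sub(1)]) (fact veronese_base_loci_collinear(1) veronese_base_loci_noncollinear(1))+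
  show "contact_base_locus (exponents {..n} d) d (veronese_variety n d) =
     {veronese {..n} d ` A | A. A \<in> smooth_sets {..n} d (proj_space {..n}) \<and> (\<exists>L. proj_line {..n} L \<and> A \<subseteq> L)}"
    by (rule eq[OF sub(2)]) (fact veronese_base_loci_collinear(2) veronese_base_loci_noncollinear(2))+
qed

end

theorem theorem3p9:
  fixes n d :: nat
  assumes "d \<ge> 2" and "n \<ge> 2"
  shows "contact_base_locus (exponents {..n} d) d (veronese_variety n d) =
           strong_base_locus (exponents {..n} d) d (veronese_variety n d)
    \<and> strong_base_locus (exponents {..n} d) d (veronese_variety n d) =
           {veronese {..n} d ` A | A. A \<in> smooth_sets {..n} d (proj_space {..n}) \<and>
              (\<exists>L. proj_line {..n} L \<and> A \<subseteq> L)}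
    \<and> (\<forall>A \<in> smooth_sets {..n} d (proj_space {..n}).
          veronese {..n} d ` A \<in> strong_base_locus (exponents {..n} d) d (veronese_variety n d) \<longrightarrow>
          (\<exists>L. proj_line {..n} L \<and> A \<subseteq> L \<and>
             contact_locus (exponents {..n} d) (veronese_variety n d) (veronese {..n} d ` A) =
               veronese {..n} d ` L \<and>
             veronese {..n} d ` L \<subseteq> veronese_variety n d \<and>
             rational_normal_curve (exponents {..n} d) d (veronese {..n} d ` L)))"
proof (cases "smooth_locus {..n} (proj_space {..n}) = proj_space {..n}")
  case True
  note ctx = assms True
  have lines: "\<exists>L. proj_line {..n} L \<and> A \<subseteq> L \<and>
      contact_locus (exponents {..n} d) (veronese_variety n d) (veronese {..n} d ` A) = veronese {..n} d ` L \<and>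
      veronese {..n} d ` L \<subseteq> veronese_variety n d \<and>
      rational_normal_curve (exponents {..n} d) d (veronese {..n} d ` L)"
    if A: "A \<in> smooth_sets {..n} d (proj_space {..n})"
      "veronese {..n} d ` A \<in> strong_base_locus (exponents {..n} d) d (veronese_variety n d)" for A
  proof -
    obtain L where L: "proj_line {..n} L" "A \<subseteq> L"
      using A veronese_base_loci_noncollinear(1)[OF ctx] by blast
    have "veronese {..n} d ` L \<subseteq> veronese_variety n d"
      unfolding veronese_variety_def by (intro image_mono proj_line_subset_proj_space L)
    then show ?thesis
      using L veronese_base_loci_collinear(3)[OF ctx A(1) L]
        rational_normal_curve_veronese_line[OF finite_atMost L(1)] by blast
  qed
  show ?thesis using veronese_base_loci_eq[OF ctx] lines by simp
next
  \<comment> \<open>The Krull dimension of projective space need not be known: the Veronese map is a homeomorphism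
    onto its image and all tangent cones have the same dimension, so otherwise both smooth loci are empty.\<close>
  case False
  then have P: "smooth_locus {..n} (proj_space {..n}) = {}"
    unfolding smooth_locus_proj_space[OF finite_atMost] by presburger
  then have "smooth_locus (exponents {..n} d) (veronese_variety n d) = {}"
    unfolding veronese_variety_def using assms(1) by (simp add: smooth_locus_veronese)
  \<comment> \<open>Only the empty set is a subset of an empty smooth locus, and its cardinality 0
    is not \<open>d\<close>.\<close>
  then have "smooth_sets (exponents {..n} d) d (veronese_variety n d) = {}"
    "smooth_sets {..n} d (proj_space {..n}) = {}"
    using P assms(1) unfolding smooth_sets_def by auto
  then show ?thesis unfolding strong_base_locus_def contact_base_locus_def by simp
qed

end
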